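(* Let $p$ be a prime, let $\lambda\in\mathbb{C}_p$ with $|\lambda|=1$ be not a root of unity, and let $f\in\mathcal{G}_{\lambda}$. Then the radius $r(f)$ of the linearization disk of $f$ about $0$ satisfies $r(f)\geq\tilde{r}(\lambda)$.
   Context: $\mathbb{C}_p$ is the completion of an algebraic closure of $\mathbb{Q}_p$, with absolute value normalized by $|p|=1/p$; $\mathcal{O}_p=\{x\in\mathbb{C}_p:|x|\le 1\}$. For $a\in\mathbb{C}_p$ and real $r\geq 0$, $S_r(a)=\{x\in\mathbb{C}_p:|x-a|=r\}$. For $\lambda\in\mathbb{C}_p$ with $|\lambda|=1$, $\lambda$ not a root of unity, $\mathcal{G}_{\lambda}:=\lambda x+x^2\mathcal{O}_p[[x]]$. Every $f\in\mathcal{G}_\lambda$ is analytically linearizable at $0$. The linearization disk $\Delta_f$ is the maximal disk about the origin on which $f$ is analytically conjugate to $T_\lambda:x\mapsto\lambda x$ (via the power series $H_f$ with $H_f(0)=0$, $H_f'(0)=1$, $H_f\circ f=\lambda H_f$), and $r(f)$ denotes its exact radius. Definition of $\tilde r(\lambda)$. Put $R(0):=0$ and $R(j):=p^{-\frac{1}{p^{j-1}(p-1)}}$ for integers $j\ge 1$. Let $\Gamma_r$ be the group of roots of unity in $\mathbb{C}_p$ of order a power of $p$ (including $1$). Let $m=\min\{n\ge 1:|1-\lambda^n|<1\}$, let $s\ge 0$ be the integer with $R(s)\le|1-\lambda^m|<R(s+1)$, let $\gamma_0\in\Gamma_r$ be an element minimizing $|\gamma_0-\lambda^m|$ over $\Gamma_r$,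 and let $t\ge 0$ be the integer with $R(t)\le|\gamma_0-\lambda^m|<R(t+1)$. Then $$\tilde r(\lambda):=R(s+1)^{\frac1m}\,p^{-\frac{s-t}{mp^s}}\,|1-\lambda^m|^{s\frac{p-1}{mp}}\,|\gamma_0-\lambda^m|^{\frac{1}{mp^{s-t}}}.$$ *)

theory Defs
  imports "HOL-Analysis.Analysis" "HOL-Computational_Algebra.Computational_Algebra"
begin

section \<open>The field of complex p-adic numbers\<close>

text \<open>The library's \<open>norm\<close> is constrained to real normed vector spaces, hence the separate constant
  for the absolute value.  Definiteness of \<open>absv\<close> follows from the metric axioms.\<close>

class complete_ultrametric_field = field_char_0 + complete_space +
  fixes absv :: "'a \<Rightarrow> real"
  assumes dist_absv: "dist x y = absv (x - y)"
    and absv_mult: "absv (x * y) = absv x * absv y"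
    and absv_add: "absv (x + y) \<le> max (absv x) (absv y)"

text \<open>
  \<open>\<complex>\<^sub>p\<close> is determined only up to isometric isomorphism, so it is introduced as a predicate on types
  that spells out the tower of \<open>\<rat>\<close>, \<open>\<rat>\<^sub>p\<close>, an algebraic closure of \<open>\<rat>\<^sub>p\<close>, and its completion.
  If \<open>p\<close> is a prime of absolute value \<open>1/p\<close>, \<open>absv\<close> restricts to the \<open>p\<close>-adic absolute value on \<open>\<rat>\<close>, and so
  the topological closure of \<open>\<rat>\<close> in a complete field is the completion \<open>\<rat>\<^sub>p\<close>.
\<close>

definition Qp :: "'a::complete_ultrametric_field set" where
  "Qp = closure \<rat>"

definition Qp_bar :: "'a::complete_ultrametric_field set" where
  "Qp_bar = {x. \<exists>q. q \<noteq> 0 \<and> (\<forall>i. coeff q i \<in> Qp) \<and> poly q x = 0}"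

definition is_Cp :: "nat \<Rightarrow> 'a::complete_ultrametric_field itself \<Rightarrow> bool" where
  "is_Cp p (_ :: 'a itself) \<longleftrightarrow>
     prime p \<and> absv (of_nat p :: 'a) = 1 / real p \<and>
     (\<forall>q :: 'a poly. degree q > 0 \<and> (\<forall>i. coeff q i \<in> Qp_bar) \<longrightarrow> (\<exists>x\<in>Qp_bar. poly q x = 0)) \<and>
     closure (Qp_bar :: 'a set) = UNIV"


section \<open>Power series and linearization\<close>

text \<open>
  The library's evaluation of formal power series (\<open>eval_fps\<close>, \<open>fps_conv_radius\<close>) is confined to
  real normed algebras, which \<open>\<complex>\<^sub>p\<close> is not.
\<close>

definition fps_converges_on :: "'a::complete_ultrametric_field fps \<Rightarrow> 'a set \<Rightarrow> bool" where
  "fps_converges_on F D \<longleftrightarrow> (\<forall>x\<in>D. summable (\<lambda>n. fps_nth F n * x ^ n))"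

definition fps_value :: "'a::complete_ultrametric_field fps \<Rightarrow> 'a \<Rightarrow> 'a" where
  "fps_value F x = (\<Sum>n. fps_nth F n * x ^ n)"

definition G_series :: "'a::complete_ultrametric_field \<Rightarrow> 'a fps set" where
  "G_series lam = {f. fps_nth f 0 = 0 \<and> fps_nth f 1 = lam \<and> (\<forall>n\<ge>2. absv (fps_nth f n) \<le> 1)}"

text \<open>The multiplier of \<open>f\<close> at the fixed point \<open>0\<close> is its linear coefficient.  \<open>H\<close> exists and is
  unique whenever that multiplier is nonzero and not a root of unity.\<close>

definition conjugacy_fps :: "'a::complete_ultrametric_field fps \<Rightarrow> 'a fps" where
  "conjugacy_fps f = (THE H. fps_nth H 0 = 0 \<and> fps_nth H 1 = 1 \<and>
                             H oo f = fps_const (fps_nth f 1) * H)"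

text \<open>\<open>G\<close> is the power series of the inverse of \<open>H\<close>, so that the conjugacy is
  bianalytic and not merely a semiconjugacy.\<close>

definition analytically_conjugate_on ::
    "'a::complete_ultrametric_field fps \<Rightarrow> 'a fps \<Rightarrow> 'a set \<Rightarrow> bool" where
  "analytically_conjugate_on H f D \<longleftrightarrow>
     fps_converges_on f D \<and> fps_value f ` D \<subseteq> D \<and>
     fps_converges_on H D \<and>
     (\<exists>G. fps_converges_on G (fps_value H ` D) \<and> (\<forall>x\<in>D. fps_value G (fps_value H x) = x)) \<and>
     (\<forall>x\<in>D. fps_value H (fps_value f x) = fps_nth f 1 * fps_value H x)"

text \<open>The radius is extended real, since the linearization disk may be the whole field (as for
  \<open>f(x) = \<lambda>x\<close>).\<close>

definition linearization_radius :: "'a::complete_ultrametric_field fps \<Rightarrow> ereal" where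
  "linearization_radius f =
     Sup {ereal r | r. r > 0 \<and> analytically_conjugate_on (conjugacy_fps f) f (ball 0 r)}"


section \<open>The lower bound\<close>

definition R :: "nat \<Rightarrow> nat \<Rightarrow> real" where
  "R p j = (if j = 0 then 0 else real p powr (- 1 / (real p ^ (j - 1) * (real p - 1))))"

definition p_power_roots_of_unity :: "nat \<Rightarrow> 'a::complete_ultrametric_field set" where
  "p_power_roots_of_unity p = {\<gamma>. \<exists>k. \<gamma> ^ (p ^ k) = 1}"

definition R_index :: "nat \<Rightarrow> real \<Rightarrow> nat" where
  "R_index p d = (THE s. R p s \<le> d \<and> d < R p (s + 1))"

definition r_tilde :: "nat \<Rightarrow> 'a::complete_ultrametric_field \<Rightarrow> real" where
  "r_tilde p lam =
    (let m = (LEAST n. n \<ge> 1 \<and> absv (1 - lam ^ n) < 1);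
         s = R_index p (absv (1 - lam ^ m));
         \<gamma>\<^sub>0 = arg_min_on (\<lambda>\<gamma>. absv (\<gamma> - lam ^ m)) (p_power_roots_of_unity p);
         t = R_index p (absv (\<gamma>\<^sub>0 - lam ^ m))
     in R p (s + 1) powr (1 / real m)
        * real p powr (- ((real s - real t) / (real m * real p ^ s)))
        * absv (1 - lam ^ m) powr (real s * ((real p - 1) / (real m * real p)))
        * absv (\<gamma>\<^sub>0 - lam ^ m) powr (1 / (real m * real p powr (real s - real t))))"

end

theory Submission imports Defs begin

text \<open>
  Comparing coefficients in \<open>H \<circ> f = \<lambda> H\<close> bounds the coefficients of the conjugacy by
  \<open>\<bar>b\<^sub>k\<^sub>+\<^sub>1\<bar> \<le> 1 / (\<bar>1 - \<lambda>\<bar> \<cdots> \<bar>1 - \<lambda>\<^sup>k\<bar>)\<close>.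
  With \<open>\<mu> = \<lambda>\<^sup>m\<close>, the factor \<open>\<bar>1 - \<lambda>\<^sup>n\<bar>\<close> is \<open>1\<close> unless \<open>n = m j\<close>, and then it depends only on the
  largest power \<open>p\<^sup>i\<close> of \<open>p\<close> dividing \<open>j\<close>.  For \<open>i < s\<close> it is \<open>\<bar>1 - \<mu>\<bar>\<close> to the power \<open>p\<^sup>i\<close>.  For \<open>i \<ge> s\<close>
  one may replace \<open>\<mu>\<close> by \<open>\<mu> / \<gamma>\<^sub>0\<close>, to which no root of unity of \<open>p\<close>-power order is closer than \<open>1\<close>;
  factoring \<open>x\<^sup>n - 1\<close> with \<open>n\<close> the \<open>t\<close>-th power of \<open>p\<close> over these roots determines the factor exactly.
  Averaging the logarithms over \<open>j\<close> shows that the product of the first \<open>k\<close> factors is at least the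
  \<open>k\<close>-th power of the claimed radius \<open>r\<close>; in fact \<open>ln r\<close> is the limit of these averages.  Hence
  \<open>\<bar>b\<^sub>k\<bar> r\<^sup>k \<le> r\<close> for all \<open>k\<close>, and the compositional inverse inherits this bound, so that \<open>H\<close> is
  bianalytic on the open disk of radius \<open>r\<close>.
\<close>

subsection \<open>Ultrametric absolute values\<close>

lemma absv_nonneg [simp]: "0 \<le> absv x"
  using dist_absv[of x 0] zero_le_dist[of x 0] by simp

lemma absv_zero_iff [simp]: "absv x = 0 \<longleftrightarrow> x = 0"
  using dist_absv[of x 0] dist_eq_0_iff[of x 0] by simp

lemma absv_zero [simp]: "absv 0 = 0"
  by simp

lemma absv_pos_iff [simp]: "0 < absv x \<longleftrightarrow> x \<noteq> 0"
  using absv_nonneg[of x] absv_zero_iff[of x] by linarith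

lemma absv_one [simp]: "absv 1 = 1"
  using absv_mult[of 1 1] absv_zero_iff[of 1] by simp

lemma absv_minus_commute: "absv (x - y) = absv (y - x)"
  using dist_absv dist_commute by metis

lemma absv_minus [simp]: "absv (- x) = absv x"
  using absv_minus_commute[of 0 x] by simp

lemma absv_diff: "absv (x - y) \<le> max (absv x) (absv y)"
  using absv_add[of x "- y"] by simp

lemma absv_power: "absv (x ^ n) = absv x ^ n"
  by (induction n) (simp_all add: absv_mult)

lemma absv_inverse: "absv (inverse x) = inverse (absv x)"
proof (cases "x = 0")
  case False
  then have "absv x * absv (inverse x) = 1"
    using absv_mult[of x "inverse x"] by simp
  then show ?thesis
    by (simp add: inverse_unique)
qed simp

lemma absv_divide: "absv (x / y) = absv x / absv y"
  by (simp add: divide_inverse absv_mult absv_inverse)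

lemma absv_prod: "absv (prod g S) = (\<Prod>i\<in>S. absv (g i))"
  by (induction S rule: infinite_finite_induct) (simp_all add: absv_mult)

lemma absv_sum_le:
  assumes "0 \<le> B" "\<And>i. i \<in> S \<Longrightarrow> absv (g i) \<le> B"
  shows "absv (sum g S) \<le> B"
  using assms(2)
proof (induction S rule: infinite_finite_induct)
  case (insert i S)
  then show ?case
    using absv_add[of "g i" "sum g S"] by (auto simp: le_max_iff_disj intro: order_trans)
qed (use assms(1) in auto)

lemma absv_sum_less:
  assumes "0 < B" "\<And>i. i \<in> S \<Longrightarrow> absv (g i) < B"
  shows "absv (sum g S) < B"
  using assms(2)
proof (induction S rule: infinite_finite_induct)
  case (insert i S)
  then show ?case
    using absv_add[of "g i" "sum g S"] by (auto intro: le_less_trans)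
qed (use assms(1) in auto)

lemma absv_add_eq_left:
  assumes "absv y < absv x"
  shows "absv (x + y) = absv x"
  using absv_add[of x y] absv_diff[of "x + y" y] assms by auto

lemma absv_eq_if_close:
  assumes "absv (x - y) < absv y"
  shows "absv x = absv y"
  using absv_add_eq_left[of "x - y" y] assms by (simp add: add.commute)

lemma absv_diff_trans: "absv (x - z) \<le> max (absv (x - y)) (absv (y - z))"
  using absv_add[of "x - y" "y - z"] by simp

lemma absv_of_nat_le: "absv (of_nat n) \<le> 1"
proof (induction n)
  case (Suc n)
  then show ?case
    using absv_add[of 1 "of_nat n"] by (auto simp: max_def split: if_splits)
qed simp

lemma absv_of_int_le: "absv (of_int n) \<le> 1"
  by (cases n rule: int_cases2) (simp_all add: absv_of_nat_le)

lemma absv_of_int_mult_le: "absv (of_int n * x) \<le> absv x"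
  using mult_right_mono[OF absv_of_int_le absv_nonneg, of n x] by (simp add: absv_mult)

lemma absv_one_minus_power_le:
  assumes "absv x \<le> 1"
  shows "absv (1 - x ^ n) \<le> absv (1 - x)"
proof -
  have "absv (\<Sum>i<n. x ^ i) \<le> 1"
    using assms by (intro absv_sum_le) (auto simp: absv_power power_le_one)
  then have "absv (1 - x) * absv (\<Sum>i<n. x ^ i) \<le> absv (1 - x) * 1"
    by (intro mult_left_mono) auto
  then show ?thesis
    by (simp add: one_diff_power_eq absv_mult)
qed

lemma absv_eq_one_if_close:
  assumes "absv (1 - x) < 1"
  shows "absv x = 1"
  using absv_eq_if_close[of x 1] assms by (simp add: absv_minus_commute)

subsection \<open>Power series on ultrametric disks\<close>

lemma sums_absv_iff:
  "g sums v \<longleftrightarrow> (\<lambda>N. absv (v - (\<Sum>n<N. g n))) \<longlonglongrightarrow> 0"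
  by (simp add: sums_def tendsto_dist_iff[of _ v] dist_absv absv_minus_commute[of v])

lemma summable_absv:
  assumes "(\<lambda>n. absv (g n)) \<longlonglongrightarrow> 0"
  shows "summable g"
proof -
  have "Cauchy (\<lambda>N. \<Sum>n<N. g n)"
  proof (rule metric_CauchyI)
    fix e :: real
    assume e: "0 < e"
    then obtain N where N: "\<And>n. n \<ge> N \<Longrightarrow> absv (g n) < e"
      using assms by (fastforce simp: lim_sequentially dist_real_def)
    have *: "absv ((\<Sum>n<b. g n) - (\<Sum>n<a. g n)) < e" if "N \<le> a" "a \<le> b" for a b
    proof -
      have "(\<Sum>n<b. g n) - (\<Sum>n<a. g n) = (\<Sum>n\<in>{..<b} - {..<a}. g n)"
        using that by (subst sum_diff) auto
      then show ?thesis
        using N that e by (auto intro!: absv_sum_less)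
    qed
    have "dist (\<Sum>n<a. g n) (\<Sum>n<b. g n) < e" if "a \<ge> N" "b \<ge> N" for a b
      using *[of a b] *[of b a] that by (cases "a \<le> b") (auto simp: dist_absv absv_minus_commute)
    then show "\<exists>M. \<forall>m\<ge>M. \<forall>n\<ge>M. dist (\<Sum>n<m. g n) (\<Sum>i<n. g i) < e"
      by blast
  qed
  then show ?thesis
    by (auto simp: summable_def sums_def convergent_def dest: Cauchy_convergent)
qed

section \<open>Coefficient bounds on a disk and evaluation of series\<close>

definition fps_bounded :: "real \<Rightarrow> real \<Rightarrow> 'a::complete_ultrametric_field fps \<Rightarrow> bool" where
  "fps_bounded r C F \<longleftrightarrow> (\<forall>n. absv (fps_nth F n) * r ^ n \<le> C)"

text \<open>Evaluation identities are checked on these truncations up to an error C (|x|/r)^N, and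
  \<open>fps_value_eqI\<close> passes to the limit.\<close>

definition fps_partial :: "nat \<Rightarrow> 'a::comm_ring_1 fps \<Rightarrow> 'a \<Rightarrow> 'a" where
  "fps_partial N F x = (\<Sum>n<N. fps_nth F n * x ^ n)"

lemma fps_boundedD: "fps_bounded r C F \<Longrightarrow> absv (fps_nth F n) * r ^ n \<le> C"
  by (simp add: fps_bounded_def)

lemma fps_bounded_nonneg: "fps_bounded r C F \<Longrightarrow> 0 \<le> C"
  by (rule order_trans[OF absv_nonneg[of "fps_nth F 0"]]) (use fps_boundedD[of r C F 0] in simp)

lemma absv_mult_le:
  assumes "absv a \<le> A" "absv b \<le> B"
  shows "absv (a * b) \<le> A * B"
  using assms order_trans[OF absv_nonneg assms(1)] by (auto simp: absv_mult intro: mult_mono)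

lemma fps_bounded_term:
  assumes "fps_bounded r C F" "0 < r"
  shows "absv (fps_nth F n * x ^ n) \<le> C * (absv x / r) ^ n"
proof -
  have "absv (fps_nth F n * x ^ n) = absv (fps_nth F n) * r ^ n * (absv x / r) ^ n"
    using assms(2) by (simp add: absv_mult absv_power power_divide)
  also have "\<dots> \<le> C * (absv x / r) ^ n"
    using assms by (intro mult_right_mono fps_boundedD) auto
  finally show ?thesis .
qed

lemma fps_bounded_partial_diff:
  assumes "fps_bounded r C F" "0 < r" "absv x < r" "N \<le> M"
  shows "absv (fps_partial M F x - fps_partial N F x) \<le> C * (absv x / r) ^ N"
proof -
  have "fps_partial M F x - fps_partial N F x = (\<Sum>n\<in>{..<M} - {..<N}. fps_nth F n * x ^ n)"
    using assms(4) unfolding fps_partial_def by (subst sum_diff) auto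
  moreover have "absv (fps_nth F n * x ^ n) \<le> C * (absv x / r) ^ N" if "n \<ge> N" for n
    using fps_bounded_nonneg[OF assms(1)] assms that
    by (intro order_trans[OF fps_bounded_term[OF assms(1,2)]] mult_left_mono power_decreasing) auto
  ultimately show ?thesis
    using fps_bounded_nonneg[OF assms(1)] assms by (auto intro!: absv_sum_le)
qed

lemma geometric_null:
  assumes "0 < r" "absv x < r"
  shows "(\<lambda>N. C * (absv x / r) ^ N) \<longlonglongrightarrow> 0"
  using assms by (auto intro!: tendsto_mult_right_zero LIMSEQ_realpow_zero)

lemma fps_bounded_summable:
  assumes "fps_bounded r C F" "0 < r" "absv x < r"
  shows "summable (\<lambda>n. fps_nth F n * x ^ n)"
  by (intro summable_absv tendsto_sandwich[OF _ _ tendsto_const geometric_null[OF assms(2,3)]])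
    (auto intro!: always_eventually fps_bounded_term[OF assms(1,2)])

text \<open>If the error e exceeded the bound, a later truncation within e of the value would also
  be within e of the N-th one, and the ultrametric inequality would give e < e.\<close>

lemma fps_value_truncation:
  assumes "fps_bounded r C F" "0 < r" "absv x < r"
  shows "absv (fps_value F x - fps_partial N F x) \<le> C * (absv x / r) ^ N"
proof (rule ccontr)
  assume *: "\<not> ?thesis"
  define e where "e = absv (fps_value F x - fps_partial N F x)"
  have "0 < e"
    using * fps_bounded_nonneg[OF assms(1)] assms(2) unfolding e_def
    by (smt (verit) absv_nonneg divide_nonneg_pos mult_nonneg_nonneg zero_le_power)
  moreover have "(\<lambda>N. absv (fps_value F x - fps_partial N F x)) \<longlonglongrightarrow> 0"
    using summable_sums[OF fps_bounded_summable[OF assms]]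
    by (simp add: sums_absv_iff fps_value_def fps_partial_def)
  ultimately obtain M0 where M0: "\<And>M. M \<ge> M0 \<Longrightarrow> absv (fps_value F x - fps_partial M F x) < e"
    by (fastforce simp: lim_sequentially dist_real_def)
  have "absv (fps_value F x - fps_partial (max M0 N) F x) < e"
    by (rule M0) simp
  moreover have "absv (fps_partial (max M0 N) F x - fps_partial N F x) < e"
    using fps_bounded_partial_diff[OF assms, of N "max M0 N"] * unfolding e_def by auto
  ultimately show False
    using absv_diff_trans[of "fps_value F x" "fps_partial N F x" "fps_partial (max M0 N) F x"]
    unfolding e_def by auto
qed

lemma fps_value_eqI:
  assumes "\<And>N. absv (v - fps_partial N F x) \<le> C * (absv x / r) ^ N" "0 < r" "absv x < r"
  shows "fps_value F x = v"
proof -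
  have "(\<lambda>n. fps_nth F n * x ^ n) sums v"
    unfolding sums_absv_iff fps_partial_def[symmetric]
    by (rule tendsto_sandwich[OF _ _ tendsto_const geometric_null[OF assms(2,3)]])
      (auto intro!: always_eventually assms(1))
  then show ?thesis
    by (simp add: fps_value_def sums_unique[symmetric])
qed

lemma fps_bounded_mult:
  assumes "fps_bounded r C F" "fps_bounded r D G" "0 < r"
  shows "fps_bounded r (C * D) (F * G)"
  unfolding fps_bounded_def
proof
  fix n
  have "absv (fps_nth F i * fps_nth G (n - i)) \<le> C * D / r ^ n" if "i \<le> n" for i
  proof -
    have "absv (fps_nth F i * fps_nth G (n - i)) * r ^ n
        = (absv (fps_nth F i) * r ^ i) * (absv (fps_nth G (n - i)) * r ^ (n - i))"
      using that by (simp add: absv_mult power_add[symmetric])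
    also have "\<dots> \<le> C * D"
      using assms fps_bounded_nonneg[OF assms(1)] by (intro mult_mono fps_boundedD) auto
    finally show ?thesis
      using assms(3) by (simp add: field_simps)
  qed
  then have "absv (fps_nth (F * G) n) \<le> C * D / r ^ n"
    unfolding fps_mult_nth
    using assms(3) fps_bounded_nonneg[OF assms(1)] fps_bounded_nonneg[OF assms(2)]
    by (intro absv_sum_le) auto
  then show "absv (fps_nth (F * G) n) * r ^ n \<le> C * D"
    using assms(3) by (simp add: field_simps)
qed

lemma fps_bounded_one [simp]: "fps_bounded r 1 1"
  by (auto simp: fps_bounded_def)

lemma fps_bounded_power:
  assumes "fps_bounded r C F" "0 < r"
  shows "fps_bounded r (C ^ l) (F ^ l)"
  by (induction l) (auto intro: fps_bounded_mult assms)

text \<open>The difference collects the products of terms with indices i, j < N and i + j >= N; each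
  of them already carries the factor (|x|/r)^N.\<close>

lemma fps_partial_mult_diff:
  assumes "fps_bounded r C F" "fps_bounded r D G" "0 < r" "absv x < r"
  shows "absv (fps_partial N F x * fps_partial N G x - fps_partial N (F * G) x)
    \<le> C * D * (absv x / r) ^ N"
proof -
  let ?h = "\<lambda>(i, j). (fps_nth F i * x ^ i) * (fps_nth G j * x ^ j)"
  have "fps_partial N F x * fps_partial N G x = sum ?h ({..<N} \<times> {..<N})"
    by (simp add: fps_partial_def sum_product sum.cartesian_product)
  moreover have "fps_partial N (F * G) x = (\<Sum>k<N. \<Sum>i\<le>k. ?h (i, k - i))"
    unfolding fps_partial_def fps_mult_nth sum_distrib_right atLeast0AtMost
    by (intro sum.cong refl) (auto simp: power_add[symmetric] algebra_simps)
  moreover have "(\<Sum>k<N. \<Sum>i\<le>k. ?h (i, k - i)) = sum ?h {(i, j). i + j < N}"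
    using sum.triangle_reindex[of "\<lambda>i j. ?h (i, j)" N] by simp
  moreover have "{(i, j). i + j < N} \<subseteq> {..<N} \<times> {..<N}"
    by auto
  ultimately have "fps_partial N F x * fps_partial N G x - fps_partial N (F * G) x
      = sum ?h ({..<N} \<times> {..<N} - {(i, j). i + j < N})"
    by (simp add: sum_diff)
  moreover have "absv (?h (i, j)) \<le> C * D * (absv x / r) ^ N" if "\<not> i + j < N" for i j
  proof -
    have "absv (?h (i, j)) \<le> (C * (absv x / r) ^ i) * (D * (absv x / r) ^ j)"
      using fps_bounded_term[OF assms(1,3)] fps_bounded_term[OF assms(2,3)]
      by (auto intro: absv_mult_le)
    also have "\<dots> = C * D * (absv x / r) ^ (i + j)"
      by (simp add: power_add)
    also have "\<dots> \<le> C * D * (absv x / r) ^ N"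
      using that assms fps_bounded_nonneg[OF assms(1)] fps_bounded_nonneg[OF assms(2)]
      by (intro mult_left_mono power_decreasing) auto
    finally show ?thesis .
  qed
  ultimately show ?thesis
    using assms fps_bounded_nonneg[OF assms(1)] fps_bounded_nonneg[OF assms(2)]
    by (auto intro!: absv_sum_le)
qed

lemma fps_value_mult:
  assumes "fps_bounded r C F" "fps_bounded r D G" "0 < r" "absv x < r"
  shows "fps_value (F * G) x = fps_value F x * fps_value G x"
proof (rule fps_value_eqI)
  fix N
  let ?q = "(absv x / r) ^ N"
  have "absv (fps_value G x) \<le> D"
    using fps_value_truncation[OF assms(2,3,4), of 0] by (simp add: fps_partial_def)
  then have 1: "absv ((fps_value F x - fps_partial N F x) * fps_value G x) \<le> C * ?q * D"
    by (intro absv_mult_le fps_value_truncation assms)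
  have "absv (fps_partial N F x) \<le> C"
    using fps_bounded_partial_diff[OF assms(1,3,4), of 0 N] by (simp add: fps_partial_def)
  then have 2: "absv (fps_partial N F x * (fps_value G x - fps_partial N G x)) \<le> C * (D * ?q)"
    by (intro absv_mult_le fps_value_truncation assms)
  have "fps_value F x * fps_value G x - fps_partial N F x * fps_partial N G x
      = (fps_value F x - fps_partial N F x) * fps_value G x
        + fps_partial N F x * (fps_value G x - fps_partial N G x)"
    by (simp add: algebra_simps)
  then have "absv (fps_value F x * fps_value G x - fps_partial N F x * fps_partial N G x)
      \<le> C * D * ?q"
    using 1 2 by (auto intro!: order_trans[OF absv_add] simp: mult_ac)
  then show "absv (fps_value F x * fps_value G x - fps_partial N (F * G) x) \<le> C * D * ?q"
    using fps_partial_mult_diff[OF assms, of N]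
    by (auto intro!: order_trans[OF absv_diff_trans[where y = "fps_partial N F x * fps_partial N G x"]])
qed (use assms in auto)

lemma fps_value_one [simp]: "fps_value 1 x = 1"
proof -
  have "(\<lambda>n. fps_nth 1 n * x ^ n) sums (\<Sum>n\<in>{0}. fps_nth 1 n * x ^ n)"
    by (rule sums_finite) auto
  then show ?thesis
    by (simp add: fps_value_def sums_unique[symmetric])
qed

lemma fps_value_power:
  assumes "fps_bounded r C F" "0 < r" "absv x < r"
  shows "fps_value (F ^ l) x = fps_value F x ^ l"
  by (induction l)
    (auto simp: fps_value_mult[OF assms(1) fps_bounded_power[OF assms(1,2)] assms(2,3)])

text \<open>For C = r the truncation error after the zero constant term is at most |x|. This is why
  series with the bound \<open>fps_bounded r r\<close> and no constant term map the open disk of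
  radius r into itself.\<close>

lemma absv_fps_value_le:
  assumes "fps_bounded r r F" "fps_nth F 0 = 0" "0 < r" "absv x < r"
  shows "absv (fps_value F x) \<le> absv x"
  using fps_value_truncation[OF assms(1,3,4), of 1] assms by (simp add: fps_partial_def)

text \<open>The value is compared with a truncation of A evaluated at F(x), and this with the
  truncation of the composite. The error r^l (|x|/r)^N in evaluating F^l is absorbed by the
  coefficient a_l of A, since |a_l| r^l <= C.\<close>

lemma fps_value_compose:
  assumes "fps_bounded r C A" "fps_bounded r r F" "fps_nth F 0 = 0" "0 < r" "absv x < r"
  shows "fps_value (A oo F) x = fps_value A (fps_value F x)"
proof (rule fps_value_eqI)
  fix N
  let ?q = "(absv x / r) ^ N" and ?y = "fps_value F x"
  note C = fps_bounded_nonneg[OF assms(1)]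
  have y: "absv ?y \<le> absv x"
    by (rule absv_fps_value_le[OF assms(2-5)])
  have "absv (fps_value A ?y - fps_partial N A ?y) \<le> C * (absv ?y / r) ^ N"
    using y assms by (intro fps_value_truncation) auto
  also have "\<dots> \<le> C * ?q"
    using y assms C by (intro mult_left_mono power_mono divide_right_mono) auto
  finally have 1: "absv (fps_value A ?y - fps_partial N A ?y) \<le> C * ?q" .
  \<comment> \<open>As F has no constant term, F^l has no coefficient below l, so the range of l can
    be made independent of n and the two sums can be swapped.\<close>
  have "fps_nth (A oo F) n = (\<Sum>l<N. fps_nth A l * fps_nth (F ^ l) n)" if "n < N" for n
    unfolding fps_compose_nth using that assms(3)
    by (intro sum.mono_neutral_left) (auto simp: startsby_zero_power_prefix)
  then have "fps_partial N (A oo F) x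
      = (\<Sum>n<N. \<Sum>l<N. fps_nth A l * (fps_nth (F ^ l) n * x ^ n))"
    unfolding fps_partial_def by (auto intro!: sum.cong simp: sum_distrib_right mult.assoc)
  also have "\<dots> = (\<Sum>l<N. fps_nth A l * fps_partial N (F ^ l) x)"
    unfolding fps_partial_def sum_distrib_left by (rule sum.swap)
  finally have "fps_partial N A ?y - fps_partial N (A oo F) x
      = (\<Sum>l<N. fps_nth A l * (fps_value (F ^ l) x - fps_partial N (F ^ l) x))"
    by (simp add: fps_partial_def fps_value_power[OF assms(2,4,5)] sum_subtractf right_diff_distrib)
  moreover have "absv (fps_nth A l * (fps_value (F ^ l) x - fps_partial N (F ^ l) x)) \<le> C * ?q"
    for l
  proof -
    have "absv (fps_nth A l * (fps_value (F ^ l) x - fps_partial N (F ^ l) x))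
        \<le> absv (fps_nth A l) * (r ^ l * ?q)"
      by (intro absv_mult_le order_refl fps_value_truncation fps_bounded_power assms)
    also have "\<dots> \<le> C * ?q"
      using mult_right_mono[OF fps_boundedD[OF assms(1), of l], of ?q] assms(4) by (simp add: mult_ac)
    finally show ?thesis .
  qed
  ultimately have "absv (fps_partial N A ?y - fps_partial N (A oo F) x) \<le> C * ?q"
    using C assms(4) by (auto intro!: absv_sum_le)
  with 1 show "absv (fps_value A ?y - fps_partial N (A oo F) x) \<le> C * ?q"
    by (auto intro!: order_trans[OF absv_diff_trans[where y = "fps_partial N A ?y"]])
qed (use assms in auto)

lemma fps_value_const_mult:
  assumes "fps_bounded r C F" "0 < r" "absv x < r"
  shows "fps_value (fps_const c * F) x = c * fps_value F x"
proof (rule fps_value_eqI)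
  fix N
  have "absv (c * (fps_value F x - fps_partial N F x)) \<le> absv c * (C * (absv x / r) ^ N)"
    by (intro absv_mult_le order_refl fps_value_truncation assms)
  then show "absv (c * fps_value F x - fps_partial N (fps_const c * F) x)
      \<le> (absv c * C) * (absv x / r) ^ N"
    by (simp add: fps_partial_def right_diff_distrib sum_distrib_left mult_ac)
qed (use assms in auto)

text \<open>Comparing coefficients of x^k in G(H(x)) = x isolates the k-th coefficient of G, because
  H^k starts with x^k. The earlier ones enter with coefficients of H^l, which
  \<open>fps_bounded_power\<close> bounds by r^l / r^k.\<close>

lemma fps_bounded_inv:
  assumes "fps_bounded r r H" "fps_nth H 0 = 0" "fps_nth H 1 = 1" "0 < r"
  shows "fps_bounded r r (fps_inv H)"
proof -
  let ?G = "fps_inv H"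
  have inv: "?G oo H = fps_X"
    using assms by (intro fps_inv) auto
  have "absv (fps_nth ?G k) * r ^ k \<le> r" for k
  proof (induction k rule: less_induct)
    case (less k)
    have "fps_nth (?G oo H) k
        = (\<Sum>l<k. fps_nth ?G l * fps_nth (H ^ l) k) + fps_nth ?G k * fps_nth (H ^ k) k"
      unfolding fps_compose_nth atLeast0AtMost lessThan_Suc_atMost[symmetric] by simp
    also have "fps_nth (H ^ k) k = 1"
      using assms by (simp add: startsby_zero_power_nth_same)
    finally have G: "fps_nth ?G k = fps_nth fps_X k - (\<Sum>l<k. fps_nth ?G l * fps_nth (H ^ l) k)"
      by (simp add: inv)
    have "absv (fps_nth ?G l * fps_nth (H ^ l) k) \<le> r / r ^ k" if "l < k" for l
    proof -
      have "absv (fps_nth ?G l * fps_nth (H ^ l) k) * r ^ k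
          = absv (fps_nth ?G l) * (absv (fps_nth (H ^ l) k) * r ^ k)"
        by (simp add: absv_mult)
      also have "\<dots> \<le> absv (fps_nth ?G l) * r ^ l"
        by (intro mult_left_mono fps_boundedD fps_bounded_power assms) auto
      also have "\<dots> \<le> r"
        by (rule less.IH[OF that])
      finally show ?thesis
        using assms(4) by (simp add: field_simps)
    qed
    then have "absv (\<Sum>l<k. fps_nth ?G l * fps_nth (H ^ l) k) \<le> r / r ^ k"
      using assms(4) by (intro absv_sum_le) auto
    moreover have "absv (fps_nth fps_X k :: 'a) \<le> r / r ^ k"
      using assms(4) by (cases "k = 1") auto
    ultimately have "absv (fps_nth ?G k) \<le> r / r ^ k"
      unfolding G by (intro order_trans[OF absv_diff]) auto
    then show ?case
      using assms(4) by (simp add: field_simps)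
  qed
  then show ?thesis
    by (simp add: fps_bounded_def)
qed

lemma analytically_conjugate_on_ball:
  assumes f: "fps_bounded r r f" "fps_nth f 0 = 0"
    and H: "fps_bounded r r H" "fps_nth H 0 = 0" "fps_nth H 1 = 1"
    and conj: "H oo f = fps_const (fps_nth f 1) * H"
    and r: "0 < r"
  shows "analytically_conjugate_on H f (ball 0 r)"
proof -
  have ball: "ball 0 r = {x :: 'a. absv x < r}"
    by (auto simp: dist_absv)
  let ?G = "fps_inv H"
  have G: "fps_bounded r r ?G"
    by (intro fps_bounded_inv H r)
  have X: "fps_value fps_X x = x" for x :: 'a
  proof -
    have "(\<lambda>n. fps_nth fps_X n * x ^ n) sums (\<Sum>n\<in>{1}. fps_nth fps_X n * x ^ n)"
      by (rule sums_finite) auto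
    then show ?thesis
      by (simp add: fps_value_def sums_unique[symmetric])
  qed
  have small: "absv (fps_value F x) < r"
    if "fps_bounded r r F" "fps_nth F 0 = 0" "absv x < r" for F :: "'a fps" and x
    using absv_fps_value_le[OF that(1,2) r that(3)] that(3) by simp
  have "fps_value ?G (fps_value H x) = x" if "absv x < r" for x
    using fps_value_compose[OF G H(1,2) r that] H by (simp add: fps_inv X)
  moreover have "fps_value H (fps_value f x) = fps_nth f 1 * fps_value H x" if "absv x < r" for x
    using fps_value_compose[OF H(1) f r that] fps_value_const_mult[OF H(1) r that]
    by (simp add: conj)
  ultimately show ?thesis
    unfolding analytically_conjugate_on_def ball fps_converges_on_def
    using small[OF f] small[OF H(1,2)] fps_bounded_summable[OF f(1) r]
      fps_bounded_summable[OF H(1) r] fps_bounded_summable[OF G r]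
    by (intro conjI exI[of _ ?G]) auto
qed

subsection \<open>The formal conjugacy\<close>

text \<open>\<open>of_nat k\<close> encodes the normalization 0, 1 of the first two coefficients;
  later ones solve the equation in \<open>conjugacy_iff\<close> for its top coefficient.\<close>

fun conjugacy_coeff :: "'a::field fps \<Rightarrow> nat \<Rightarrow> 'a" where
  "conjugacy_coeff f k =
    (if k \<le> 1 then of_nat k
     else (\<Sum>l<k. conjugacy_coeff f l * fps_nth (f ^ l) k) / (fps_nth f 1 - fps_nth f 1 ^ k))"

declare conjugacy_coeff.simps [simp del]

lemma conjugacy_iff:
  fixes f :: "'a::field fps"
  assumes "fps_nth f 0 = 0"
  shows "H oo f = fps_const (fps_nth f 1) * H \<longleftrightarrow>
    (\<forall>k. (\<Sum>l<k. fps_nth H l * fps_nth (f ^ l) k) = (fps_nth f 1 - fps_nth f 1 ^ k) * fps_nth H k)"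
proof -
  have "fps_nth (H oo f) k
      = (\<Sum>l<k. fps_nth H l * fps_nth (f ^ l) k) + fps_nth H k * fps_nth f 1 ^ k" for k
    unfolding fps_compose_nth atLeast0AtMost lessThan_Suc_atMost[symmetric]
    using assms by (simp add: startsby_zero_power_nth_same)
  then show ?thesis
    by (auto simp: fps_eq_iff algebra_simps eq_diff_eq)
qed

lemma multiplier_diff_nonzero:
  fixes lam :: "'a::field"
  assumes "lam \<noteq> 0" "\<forall>n\<ge>1. lam ^ n \<noteq> 1" "k \<ge> 2"
  shows "lam - lam ^ k \<noteq> 0"
proof
  assume "lam - lam ^ k = 0"
  then have "lam * lam ^ (k - 1) = lam * 1"
    using assms(3) by (simp add: power_eq_if split: if_splits)
  then show False
    using assms by auto
qed

text \<open>The recursion has nonzero divisors and therefore exactly one normalized solution;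
  existence and uniqueness together justify the \<open>THE\<close> in
  \<open>conjugacy_fps\<close>.\<close>

lemma conjugacy_fps_properties:
  fixes f :: "'a::complete_ultrametric_field fps"
  assumes "fps_nth f 0 = 0" "fps_nth f 1 \<noteq> 0" "\<forall>n\<ge>1. fps_nth f 1 ^ n \<noteq> 1"
  shows "fps_nth (conjugacy_fps f) 0 = 0" "fps_nth (conjugacy_fps f) 1 = 1"
    "conjugacy_fps f oo f = fps_const (fps_nth f 1) * conjugacy_fps f"
proof -
  let ?P = "\<lambda>H. fps_nth H 0 = 0 \<and> fps_nth H 1 = 1 \<and> H oo f = fps_const (fps_nth f 1) * H"
  let ?H = "Abs_fps (conjugacy_coeff f)"
  have low: "conjugacy_coeff f 0 = 0" "conjugacy_coeff f 1 = 1"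
    by (simp_all add: conjugacy_coeff.simps)
  have "(\<Sum>l<k. fps_nth ?H l * fps_nth (f ^ l) k) = (fps_nth f 1 - fps_nth f 1 ^ k) * fps_nth ?H k"
    for k
  proof (cases "k \<le> 1")
    case True
    then have "k = 0 \<or> k = 1"
      by auto
    then show ?thesis
      using low by auto
  next
    case False
    then show ?thesis
      using multiplier_diff_nonzero[OF assms(2,3), of k] conjugacy_coeff.simps[of f k] by simp
  qed
  then have "?P ?H"
    using low assms(1) by (subst conjugacy_iff) auto
  moreover have "H = ?H" if H: "?P H" for H
  proof -
    have rec: "(\<Sum>l<k. fps_nth H l * fps_nth (f ^ l) k) = (fps_nth f 1 - fps_nth f 1 ^ k) * fps_nth H k"
      for k
      using H conjugacy_iff[OF assms(1)] by blast
    have "fps_nth H k = conjugacy_coeff f k" for k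
    proof (induction k rule: less_induct)
      case (less k)
      show ?case
      proof (cases "k \<le> 1")
        case True
        then have "k = 0 \<or> k = 1"
          by auto
        then show ?thesis
          using low H by auto
      next
        case False
        have "(\<Sum>l<k. conjugacy_coeff f l * fps_nth (f ^ l) k)
            = (fps_nth f 1 - fps_nth f 1 ^ k) * fps_nth H k"
          unfolding rec[symmetric] by (intro sum.cong) (auto simp: less.IH)
        then show ?thesis
          using False multiplier_diff_nonzero[OF assms(2,3), of k]
          by (subst conjugacy_coeff.simps) simp
      qed
    qed
    then show ?thesis
      by (simp add: fps_eq_iff)
  qed
  ultimately have "?P (conjugacy_fps f)"
    unfolding conjugacy_fps_def by (rule theI)
  then show "fps_nth (conjugacy_fps f) 0 = 0" "fps_nth (conjugacy_fps f) 1 = 1"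
    "conjugacy_fps f oo f = fps_const (fps_nth f 1) * conjugacy_fps f"
    by auto
qed

text \<open>The products of small divisors do not increase with their length, so by induction every
  summand of the recursion is at most the reciprocal of the longest previous product; solving for
  the new coefficient contributes the last factor |1 - lambda^k|.\<close>

lemma conjugacy_coeff_bound:
  assumes f: "fps_bounded 1 1 f" "fps_nth f 0 = 0" and lam: "absv (fps_nth f 1) = 1"
    and H: "fps_nth H 0 = 0" "fps_nth H 1 = 1" "H oo f = fps_const (fps_nth f 1) * H"
  shows "absv (fps_nth H (Suc k)) * (\<Prod>n=1..k. absv (1 - fps_nth f 1 ^ n)) \<le> 1"
proof (induction k rule: less_induct)
  case (less k)
  let ?P = "\<lambda>k. \<Prod>n=1..k. absv (1 - fps_nth f 1 ^ n)"
  show ?case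
  proof (cases k)
    case 0
    then show ?thesis
      using H by simp
  next
    case (Suc j)
    have le1: "absv (1 - fps_nth f 1 ^ n) \<le> 1" for n
      using absv_diff[of 1 "fps_nth f 1 ^ n"] by (simp add: absv_power lam[simplified])
    have mono: "?P j \<le> ?P i" if "i \<le> j" for i
      using that
    proof (induction rule: dec_induct)
      case (step n)
      have "?P n * absv (1 - fps_nth f 1 ^ Suc n) \<le> ?P n * 1"
        by (intro mult_left_mono le1 prod_nonneg) auto
      with step show ?case
        by simp
    qed simp
    have small: "absv (fps_nth H l * fps_nth (f ^ l) (Suc k)) * ?P j \<le> 1" if "l < Suc k" for l
    proof (cases l)
      case 0
      then show ?thesis
        using H by simp
    next
      case (Suc i)
      have "absv (fps_nth (f ^ l) (Suc k)) \<le> 1"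
        using fps_boundedD[OF fps_bounded_power[OF f(1)], of l "Suc k"] by simp
      then have "absv (fps_nth H l * fps_nth (f ^ l) (Suc k)) * ?P j \<le> absv (fps_nth H l) * 1 * ?P i"
        unfolding absv_mult using mono[of i] that Suc \<open>k = Suc j\<close>
        by (intro mult_mono) (auto intro!: prod_nonneg)
      also have "\<dots> \<le> 1"
        using less.IH[of i] that Suc by simp
      finally show ?thesis .
    qed
    let ?S = "\<Sum>l<Suc k. fps_nth H l * fps_nth (f ^ l) (Suc k)"
    have "?S = (fps_nth f 1 - fps_nth f 1 ^ Suc k) * fps_nth H (Suc k)"
      using H(3) conjugacy_iff[OF f(2)] by blast
    \<comment> \<open>Extracting the unit lambda turns the divisor for the coefficient k + 1 into 1
      - lambda^k.\<close>
    also have "\<dots> = fps_nth f 1 * (1 - fps_nth f 1 ^ k) * fps_nth H (Suc k)"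
      by (simp add: algebra_simps)
    finally have "absv ?S = absv (1 - fps_nth f 1 ^ k) * absv (fps_nth H (Suc k))"
      by (simp add: absv_mult lam[simplified])
    moreover have "absv ?S * ?P j \<le> 1"
    proof (cases "?P j = 0")
      case False
      then have pos: "0 < ?P j"
        by (simp add: less_le prod_nonneg)
      have "absv ?S \<le> 1 / ?P j"
        using small pos by (intro absv_sum_le) (auto simp: field_simps)
      then show ?thesis
        using pos by (simp add: field_simps)
    qed (simp only: mult_zero_right zero_le_one)
    ultimately show ?thesis
      using Suc by (simp add: mult_ac)
  qed
qed

subsection \<open>The thresholds \<open>R\<close> and roots of unity\<close>

context
  fixes p :: nat
  assumes prime_p: "prime p"
begin

lemma p_gt_1: "1 < p"
  using prime_p by (rule prime_gt_1_nat)

lemma R_0 [simp]: "R p 0 = 0"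
  by (simp add: R_def)

lemma R_Suc: "R p (Suc j) = real p powr (- 1 / (real p ^ j * (real p - 1)))"
  by (simp add: R_def)

lemma R_Suc_pos: "0 < R p (Suc j)"
  using p_gt_1 by (simp add: R_Suc)

lemma R_1_power: "R p 1 ^ (p - 1) = 1 / real p"
proof -
  have "R p 1 ^ (p - 1) = R p 1 powr real (p - 1)"
    using R_Suc_pos[of 0] by (simp add: powr_realpow)
  also have "\<dots> = 1 / real p"
    using p_gt_1 by (simp add: R_Suc powr_powr)
  finally show ?thesis .
qed

lemma R_Suc_power: "R p (Suc j) ^ (p ^ j) = R p 1"
proof -
  have "R p (Suc j) ^ (p ^ j) = R p (Suc j) powr real (p ^ j)"
    using R_Suc_pos[of j] by (simp add: powr_realpow del: of_nat_power)
  also have "\<dots> = R p 1"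
    using p_gt_1 by (simp add: R_Suc powr_powr)
  finally show ?thesis .
qed

text \<open>Taking p^j-th powers carries the threshold R(j + 1) to R(1), so every comparison with a
  threshold becomes one at R(1).\<close>

lemma R_Suc_le_iff: "0 \<le> x \<Longrightarrow> R p (Suc j) \<le> x \<longleftrightarrow> R p 1 \<le> x ^ (p ^ j)"
  and le_R_Suc_iff: "0 \<le> x \<Longrightarrow> x \<le> R p (Suc j) \<longleftrightarrow> x ^ (p ^ j) \<le> R p 1"
  using power_mono_iff[of "R p (Suc j)" x "p ^ j"] power_mono_iff[of x "R p (Suc j)" "p ^ j"]
    p_gt_1 R_Suc_pos[of j] unfolding R_Suc_power by auto

lemma less_R_Suc_iff: "0 \<le> x \<Longrightarrow> x < R p (Suc j) \<longleftrightarrow> x ^ (p ^ j) < R p 1"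
  using R_Suc_le_iff[of x j] by linarith

lemma R_Suc_less_iff: "0 \<le> x \<Longrightarrow> R p (Suc j) < x \<longleftrightarrow> R p 1 < x ^ (p ^ j)"
  using le_R_Suc_iff[of x j] by linarith

text \<open>R(1) is the size at which |x|^p and |p x| balance, because R(1)^(p - 1) = 1/p.\<close>

lemma R_1_le_iff: "0 \<le> x \<Longrightarrow> R p 1 \<le> x \<longleftrightarrow> 1 / real p \<le> x ^ (p - 1)"
  and le_R_1_iff: "0 \<le> x \<Longrightarrow> x \<le> R p 1 \<longleftrightarrow> x ^ (p - 1) \<le> 1 / real p"
  using power_mono_iff[of "R p 1" x "p - 1"] power_mono_iff[of x "R p 1" "p - 1"]
    p_gt_1 R_Suc_pos[of 0] unfolding R_1_power by auto

lemma less_R_1_iff: "0 \<le> x \<Longrightarrow> x < R p 1 \<longleftrightarrow> x ^ (p - 1) < 1 / real p"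
  using R_1_le_iff[of x] by linarith

lemma R_1_less_iff: "0 \<le> x \<Longrightarrow> R p 1 < x \<longleftrightarrow> 1 / real p < x ^ (p - 1)"
  using le_R_1_iff[of x] by linarith

lemma strict_mono_R: "strict_mono (R p)"
proof (rule strict_monoI_Suc)
  fix j
  show "R p j < R p (Suc j)"
  proof (cases j)
    case 0
    then show ?thesis
      using R_Suc_pos by simp
  next
    case (Suc i)
    have "real p ^ i * (real p - 1) < real p ^ Suc i * (real p - 1)"
      using p_gt_1 by (intro mult_strict_right_mono power_strict_increasing) auto
    then have "- 1 / (real p ^ i * (real p - 1)) < - 1 / (real p ^ Suc i * (real p - 1))"
      using p_gt_1 by (intro divide_strict_left_mono_neg) auto
    then show ?thesis
      unfolding Suc R_Suc using p_gt_1 by (intro powr_less_mono) auto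
  qed
qed

lemma R_mono: "i \<le> j \<Longrightarrow> R p i \<le> R p j"
  using strict_mono_less_eq[OF strict_mono_R] by blast

lemma R_less_1: "R p j < 1"
proof (cases j)
  case (Suc i)
  then show ?thesis
    using p_gt_1 powr_less_mono[of "- 1 / (real p ^ i * (real p - 1))" 0 "real p"]
    by (simp add: R_Suc)
qed simp

text \<open>The intervals from R(s) to R(s + 1) tile the half-open unit interval: powers of d
  eventually fall below R(1), so some threshold lies above d, and strict monotonicity makes the
  index unique.\<close>

lemma R_index:
  assumes "0 \<le> d" "d < 1"
  shows "R p (R_index p d) \<le> d" "d < R p (Suc (R_index p d))"
proof -
  have "\<exists>j. d < R p (Suc j)"
  proof -
    obtain n where n: "d ^ n < R p 1"
      using real_arch_pow_inv[OF _ assms(2)] R_Suc_pos[of 0] by auto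
    have "d ^ (p ^ n) \<le> d ^ n"
      using assms p_gt_1 less_exp[of n] power_mono[of 2 p n] by (intro power_decreasing) linarith+
    then show ?thesis
      using n assms less_R_Suc_iff by (meson le_less_trans)
  qed
  define s where "s = (LEAST j. d < R p (Suc j))"
  have upper: "d < R p (Suc s)"
    unfolding s_def by (rule LeastI_ex[of "\<lambda>j. d < R p (Suc j)"]) fact
  have lower: "R p s \<le> d"
  proof (cases s)
    case (Suc i)
    then have "\<not> d < R p (Suc i)"
      using not_less_Least[of i "\<lambda>j. d < R p (Suc j)"] by (simp add: s_def)
    then show ?thesis
      using Suc by simp
  qed (use assms in simp)
  have unique: "s' = s" if "R p s' \<le> d \<and> d < R p (s' + 1)" for s'
  proof -
    have "R p s < R p (s' + 1)" "R p s' < R p (s + 1)"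
      using that upper lower by auto
    then have "s < s' + 1" "s' < s + 1"
      by (auto simp only: strict_mono_less[OF strict_mono_R])
    then show ?thesis
      by linarith
  qed
  have "R_index p d = s"
    unfolding R_index_def
  proof (rule the_equality)
    show "R p s \<le> d \<and> d < R p (s + 1)"
      using upper lower by simp
  qed (rule unique)
  then show "R p (R_index p d) \<le> d" "d < R p (Suc (R_index p d))"
    using upper lower by auto
qed

text \<open>If z^i = 1, a Bezout relation gives z^g = 1 for g = gcd(i, p^(k+1)). Since 0 < i <
  p^(k+1), this g is some p^e with e <= k, contradicting the assumption on z^(p^k).\<close>

lemma root_of_unity_order:
  fixes z :: "'b::field"
  assumes "z ^ (p ^ Suc k) = 1" "z ^ (p ^ k) \<noteq> 1" "0 < i" "i < p ^ Suc k"
  shows "z ^ i \<noteq> 1"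
proof
  assume "z ^ i = 1"
  obtain a b where ab: "i * a = p ^ Suc k * b + gcd i (p ^ Suc k)"
    using bezout_nat[of i "p ^ Suc k"] assms(3) by auto
  have "1 = z ^ (i * a)"
    by (simp only: power_mult \<open>z ^ i = 1\<close> power_one)
  also have "\<dots> = z ^ gcd i (p ^ Suc k)"
    unfolding ab power_add power_mult[of z "p ^ Suc k"] assms(1) by simp
  finally have 1: "z ^ gcd i (p ^ Suc k) = 1" ..
  obtain e where e: "gcd i (p ^ Suc k) = p ^ e"
    using divides_primepow_nat[OF prime_p, of "gcd i (p ^ Suc k)" "Suc k"] by auto
  have "p ^ e \<le> i"
    using assms(3) by (simp flip: e)
  then have "p ^ e < p ^ Suc k"
    using assms(4) by linarith
  then have "e \<le> k"
    using p_gt_1 power_less_imp_less_exp[of p e "Suc k"] by auto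
  then have "z ^ (p ^ k) = (z ^ (p ^ e)) ^ (p ^ (k - e))"
    by (simp add: power_add[symmetric] power_mult[symmetric])
  then show False
    using 1 e assms(2) by simp
qed

end

section \<open>Factoring x^n - 1 over the roots of unity\<close>

lemma prod_linear_dvd:
  fixes q :: "'a::idom poly"
  assumes "finite S" "\<And>a. a \<in> S \<Longrightarrow> poly q a = 0"
  shows "(\<Prod>a\<in>S. [:- a, 1:]) dvd q"
  using assms
proof (induction S)
  case (insert a S)
  then obtain h where h: "q = (\<Prod>a\<in>S. [:- a, 1:]) * h"
    by (auto elim: dvdE)
  have "poly (\<Prod>a\<in>S. [:- a, 1:]) a \<noteq> 0"
    using insert.hyps by (auto simp: poly_prod)
  then have "poly h a = 0"
    using insert.prems[of a] h by simp
  then have "[:- a, 1:] dvd h"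
    by (simp add: poly_eq_0_iff_dvd)
  then have "[:- a, 1:] * (\<Prod>a\<in>S. [:- a, 1:]) dvd h * (\<Prod>a\<in>S. [:- a, 1:])"
    by (rule mult_dvd_mono) simp
  then show ?case
    unfolding h by (simp only: prod.insert[OF insert.hyps] mult.commute[of h])
qed simp

text \<open>The first n powers of z are distinct roots of x^n - 1, so the product of their linear
  factors divides it; both polynomials are monic of degree n.\<close>

lemma one_minus_power_prod:
  fixes z y :: "'a::idom"
  assumes "z ^ n = 1" "\<And>i. 0 < i \<Longrightarrow> i < n \<Longrightarrow> z ^ i \<noteq> 1" "0 < n"
  shows "y ^ n - 1 = (\<Prod>i<n. y - z ^ i)"
proof -
  define q :: "'a poly" where "q = monom 1 n - 1"
  have "z \<noteq> 0"
    using assms(1,3) by (auto simp: power_0_left)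
  have "i = j" if "z ^ i = z ^ j" "i \<le> j" "j < n" for i j
  proof (rule ccontr)
    assume "i \<noteq> j"
    have "z ^ i * z ^ (j - i) = z ^ i * 1"
      using that power_add[of z i "j - i"] by simp
    then have "z ^ (j - i) = 1"
      using \<open>z \<noteq> 0\<close> by (subst (asm) mult_cancel_left) auto
    then show False
      using assms(2)[of "j - i"] that \<open>i \<noteq> j\<close> by auto
  qed
  then have inj: "inj_on (\<lambda>i. z ^ i) {..<n}"
    by (intro inj_onI) (metis lessThan_iff nle_le)
  define P :: "'a poly" where "P = (\<Prod>i<n. [:- (z ^ i), 1:])"
  have "P = (\<Prod>a\<in>(\<lambda>i. z ^ i) ` {..<n}. [:- a, 1:])"
    unfolding P_def using inj by (simp add: prod.reindex)
  moreover have "(z ^ i) ^ n = 1" for i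
    using assms(1) by (metis power_mult mult.commute power_one)
  ultimately have "P dvd q"
    using assms by (auto intro!: prod_linear_dvd simp: q_def poly_monom)
  then obtain h where h: "q = P * h" ..
  have degq: "degree q = n"
    unfolding q_def using assms(3) degree_add_eq_left[of "- 1" "monom (1 :: 'a) n"]
    by (simp add: degree_monom_eq)
  have degP: "degree P = n"
    unfolding P_def by (subst degree_prod_eq_sum_degree) auto
  have lcP: "lead_coeff P = 1"
    unfolding P_def by (simp add: lead_coeff_prod)
  have lcq: "lead_coeff q = 1"
    unfolding degq using assms(3) by (simp add: q_def)
  have "q \<noteq> 0"
    using lcq by auto
  then have "degree h = 0"
    using degree_mult_eq[of P h] degP degq h by auto
  then obtain c where "h = [:c:]"
    by (auto elim: degree_eq_zeroE)
  moreover have "lead_coeff h = 1"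
    using lcq lcP h by (simp add: lead_coeff_mult)
  ultimately have "q = P"
    using h by simp
  then have "poly q y = poly P y"
    by simp
  then show ?thesis
    by (simp add: q_def P_def poly_monom poly_prod)
qed

lemma Rats_subset_Qp_bar: "\<rat> \<subseteq> Qp_bar"
proof
  fix a :: "'a::complete_ultrametric_field"
  assume "a \<in> \<rat>"
  then have *: "coeff [:- a, 1:] i \<in> Qp" for i
    using closure_subset[of \<rat>] unfolding Qp_def
    by (cases i) (auto simp: coeff_pCons split: nat.splits)
  show "a \<in> Qp_bar"
    unfolding Qp_bar_def using * by (intro CollectI exI[of _ "[:- a, 1:]"]) auto
qed

text \<open>For k = l + 1 a root z is taken of the cyclotomic polynomial q, the sum of x^(j p^l)
  over j < p. With w = z^(p^l) one has (1 - w) q(z) = 1 - w^p, while w = 1 would give q(z) =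
  p.\<close>

lemma exists_primitive_root:
  assumes Cp: "is_Cp p TYPE('a::complete_ultrametric_field)"
  obtains z :: "'a::complete_ultrametric_field" where "z ^ (p ^ k) = 1" "\<And>i. 0 < i \<Longrightarrow> i < p ^ k \<Longrightarrow> z ^ i \<noteq> 1"
proof (cases k)
  case 0
  then show ?thesis
    by (intro that[of 1]) auto
next
  case (Suc l)
  have p: "prime p"
    using Cp by (simp add: is_Cp_def)
  note p1 = p_gt_1[OF p]
  define q :: "'a poly" where "q = (\<Sum>j<p. monom 1 (j * p ^ l))"
  have poly_q: "poly q y = (\<Sum>j<p. (y ^ (p ^ l)) ^ j)" for y
    by (simp add: q_def poly_sum poly_monom power_mult[symmetric] mult.commute)
  have "coeff q i \<in> \<rat>" for i
    by (auto simp: q_def coeff_sum intro!: Rats_sum)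
  then have "coeff q i \<in> Qp_bar" for i
    using Rats_subset_Qp_bar by blast
  moreover have "degree q > 0"
  proof (rule ccontr)
    assume "\<not> 0 < degree q"
    then have "poly q 0 = poly q 1"
      by (auto elim: degree_eq_zeroE)
    then have "of_nat p = (1 :: 'a)"
      using p1 by (simp add: poly_q power_0_left sum.delta if_distrib cong: if_cong)
    then show False
      using p1 of_nat_eq_iff[of p 1, where ?'a = 'a] by simp
  qed
  ultimately obtain z where z: "poly q z = 0"
    using Cp unfolding is_Cp_def by blast
  let ?w = "z ^ (p ^ l)"
  have "1 - ?w ^ p = (1 - ?w) * (\<Sum>j<p. ?w ^ j)"
    by (rule one_diff_power_eq)
  moreover have "z ^ (p ^ k) = ?w ^ p"
    by (simp add: Suc power_mult[symmetric] mult.commute)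
  ultimately have "z ^ (p ^ k) = 1"
    using z by (simp add: poly_q)
  moreover have "?w \<noteq> 1"
    using z p1 by (auto simp: poly_q)
  ultimately show ?thesis
    using root_of_unity_order[OF p] that[of z] Suc by blast
qed

subsection \<open>Distance of iterated powers to one\<close>

locale residue_char =
  fixes p :: nat and ty :: "'a::complete_ultrametric_field itself"
  assumes prime_p: "prime p" and absv_p: "absv (of_nat p :: 'a) = 1 / real p"
begin

lemma absv_of_int_dvd:
  assumes "int p dvd k"
  shows "absv (of_int k :: 'a) \<le> 1 / real p"
proof -
  obtain l where "k = int p * l"
    using assms by (auto elim: dvdE)
  then have "(of_int k :: 'a) = of_int l * of_nat p"
    by simp
  then show ?thesis
    using absv_of_int_mult_le[of l "of_nat p :: 'a"] absv_p by simp
qed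

lemma inverse_mod_p:
  assumes "\<not> int p dvd k"
  obtains u v where "u * k + v * int p = 1"
proof -
  have "coprime (int p) k"
    using assms prime_p by (intro prime_imp_coprime) auto
  then show ?thesis
    using that bezout_int[of k "int p"] by (auto simp: coprime_iff_gcd_eq_1 gcd.commute)
qed

lemma absv_of_int_unit:
  assumes "\<not> int p dvd k"
  shows "absv (of_int k :: 'a) = 1"
proof (rule ccontr)
  assume *: "absv (of_int k :: 'a) \<noteq> 1"
  obtain v u where "v * k + u * int p = 1"
    by (rule inverse_mod_p[OF assms])
  then have "u * int p + v * k = 1"
    by simp
  then have 1: "(of_int u * of_nat p + of_int v * of_int k :: 'a) = 1"
    by (metis of_int_add of_int_mult of_int_1 of_int_of_nat_eq)
  have "absv (of_int u * of_nat p :: 'a) < 1"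
    using absv_of_int_mult_le[of u "of_nat p :: 'a"] absv_p p_gt_1[OF prime_p]
    by (auto intro: le_less_trans)
  moreover have "absv (of_int v * of_int k :: 'a) < 1"
    using absv_of_int_mult_le[of v "of_int k :: 'a"] * absv_of_int_le[of k, where ?'a = 'a]
    by linarith
  ultimately show False
    using absv_add[of "of_int u * of_nat p" "of_int v * of_int k :: 'a"] 1 by simp
qed

text \<open>In the binomial expansion of (1 - u)^p with u = 1 - y the two extreme terms p u and
  (-u)^p are kept; the middle ones are divisible by p and by u^2 and form w. Below R(1) the linear
  term dominates strictly, above R(1) the p-th power does.\<close>

lemma power_p_expansion:
  fixes y :: 'a
  assumes "absv (1 - y) \<le> 1"
  obtains w where "1 - y ^ p = of_nat p * (1 - y) - w - (- (1 - y)) ^ p"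
    and "absv w \<le> absv (1 - y) ^ 2 / real p"
proof
  define u where "u = 1 - y"
  let ?g = "\<lambda>k. of_nat (p choose k) * (- u) ^ k"
  define w where "w = (\<Sum>k=2..<p. ?g k)"
  have p: "1 < p"
    by (rule p_gt_1[OF prime_p])
  have "y ^ p = (- u + 1) ^ p"
    by (simp add: u_def)
  also have "\<dots> = (\<Sum>k\<le>p. ?g k)"
    unfolding binomial_ring by simp
  also have "{..p} = insert 0 (insert 1 (insert p {2..<p}))"
    using p by auto
  also have "(\<Sum>k\<in>insert 0 (insert 1 (insert p {2..<p})). ?g k) = 1 - of_nat p * u + w + (- u) ^ p"
    using p unfolding w_def by (subst sum.insert; simp)+
  finally show "1 - y ^ p = of_nat p * (1 - y) - w - (- (1 - y)) ^ p"
    by (simp add: u_def)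
  have "absv (?g k) \<le> absv u ^ 2 / real p" if "k \<in> {2..<p}" for k
  proof -
    have "p dvd (p choose k)"
      using that prime_p by (intro dvd_choose_prime) auto
    then have "absv (of_nat (p choose k) :: 'a) \<le> 1 / real p"
      using absv_of_int_dvd[of "int (p choose k)"] by simp
    moreover have "absv u ^ k \<le> absv u ^ 2"
      using that assms unfolding u_def by (intro power_decreasing) auto
    then have "absv ((- u) ^ k) \<le> absv u ^ 2"
      by (simp add: absv_power)
    ultimately show ?thesis
      using absv_mult_le by fastforce
  qed
  then show "absv w \<le> absv (1 - y) ^ 2 / real p"
    unfolding w_def u_def[symmetric] by (intro absv_sum_le) auto
qed

lemma power_p_eq: "absv x ^ p = absv x * absv x ^ (p - 1)"
  using p_gt_1[OF prime_p] by (simp add: power_eq_if)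

lemma absv_one_minus_power_p_le:
  fixes y :: 'a
  assumes "absv (1 - y) \<le> 1"
  shows "absv (1 - y ^ p) \<le> max (absv (1 - y) / real p) (absv (1 - y) ^ p)"
proof -
  let ?d = "absv (1 - y)"
  obtain w where w: "1 - y ^ p = of_nat p * (1 - y) - w - (- (1 - y)) ^ p"
    "absv w \<le> ?d ^ 2 / real p"
    by (rule power_p_expansion[OF assms])
  have "?d ^ 2 \<le> ?d"
    using assms by (simp add: power2_eq_square mult_left_le)
  then have "absv w \<le> ?d / real p"
    using w(2) by (meson divide_right_mono of_nat_0_le_iff order_trans)
  then have "absv (of_nat p * (1 - y) - w) \<le> ?d / real p"
    using absv_p by (intro order_trans[OF absv_diff]) (simp add: absv_mult)
  moreover have "absv ((- (1 - y)) ^ p) = ?d ^ p"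
    by (simp only: absv_power absv_minus)
  ultimately show ?thesis
    unfolding w(1) by (intro order_trans[OF absv_diff]) auto
qed

lemma absv_one_minus_power_p_large:
  fixes y :: 'a
  assumes "absv (1 - y) \<le> 1" "R p 1 < absv (1 - y)"
  shows "absv (1 - y ^ p) = absv (1 - y) ^ p"
proof -
  let ?d = "absv (1 - y)"
  obtain w where w: "1 - y ^ p = of_nat p * (1 - y) - w - (- (1 - y)) ^ p"
    "absv w \<le> ?d ^ 2 / real p"
    by (rule power_p_expansion[OF assms(1)])
  have "?d ^ 2 \<le> ?d"
    using assms by (simp add: power2_eq_square mult_left_le)
  then have "absv w \<le> ?d / real p"
    using w(2) by (meson divide_right_mono of_nat_0_le_iff order_trans)
  then have 1: "absv (of_nat p * (1 - y) - w) \<le> ?d / real p"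
    using absv_p by (intro order_trans[OF absv_diff]) (simp add: absv_mult)
  have "0 < ?d"
    using assms(2) R_Suc_pos[OF prime_p, of 0] by (simp del: absv_pos_iff)
  moreover have "1 / real p < ?d ^ (p - 1)"
    using assms(2) R_1_less_iff[OF prime_p, of ?d] by simp
  ultimately have "?d * (1 / real p) < ?d * ?d ^ (p - 1)"
    by (intro mult_strict_left_mono)
  then have "?d / real p < ?d ^ p"
    by (simp add: power_p_eq)
  then have "absv (of_nat p * (1 - y) - w) < absv (- ((- (1 - y)) ^ p))"
    using 1 by (simp only: absv_power absv_minus)
  then have "absv (- ((- (1 - y)) ^ p) + (of_nat p * (1 - y) - w)) = absv (- ((- (1 - y)) ^ p))"
    by (rule absv_add_eq_left)
  then show ?thesis
    unfolding w(1) by (simp only: absv_power absv_minus) (simp add: algebra_simps)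
qed

lemma absv_one_minus_power_p_small:
  fixes y :: 'a
  assumes "absv (1 - y) < R p 1"
  shows "absv (1 - y ^ p) = absv (1 - y) / real p"
proof (cases "y = 1")
  case False
  let ?d = "absv (1 - y)"
  note p = p_gt_1[OF prime_p]
  have d: "0 < ?d" "?d < 1"
    using False assms R_less_1[OF prime_p, of 1] by auto
  obtain w where w: "1 - y ^ p = of_nat p * (1 - y) - w - (- (1 - y)) ^ p"
    "absv w \<le> ?d ^ 2 / real p"
    using power_p_expansion[of y] d by auto
  have "?d * ?d < ?d * 1"
    using d by (intro mult_strict_left_mono)
  then have 1: "absv w < ?d / real p"
    using w(2) p by (simp add: power2_eq_square divide_right_mono field_simps)
  have "?d ^ (p - 1) < 1 / real p"
    using assms less_R_1_iff[OF prime_p, of ?d] by simp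
  then have "?d * ?d ^ (p - 1) < ?d * (1 / real p)"
    using d by (intro mult_strict_left_mono)
  then have 2: "?d ^ p < ?d / real p"
    by (simp add: power_p_eq)
  have "absv ((- (1 - y)) ^ p) = ?d ^ p"
    by (simp only: absv_power absv_minus)
  then have "absv (w + (- (1 - y)) ^ p) < ?d / real p"
    using absv_add[of w "(- (1 - y)) ^ p"] 1 2 by linarith
  moreover have 3: "absv (of_nat p * (1 - y)) = ?d / real p"
    by (simp add: absv_mult absv_p)
  ultimately have "absv (- (w + (- (1 - y)) ^ p)) < absv (of_nat p * (1 - y))"
    by (simp only: absv_minus)
  then have "absv (of_nat p * (1 - y) + - (w + (- (1 - y)) ^ p)) = ?d / real p"
    unfolding 3[symmetric] by (rule absv_add_eq_left)
  then show ?thesis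
    unfolding w(1) by (simp add: algebra_simps)
qed simp

lemma power_power_Suc: "(x :: 'b::monoid_mult) ^ (p ^ Suc i) = (x ^ (p ^ i)) ^ p"
  by (simp only: power_Suc2 power_mult)

text \<open>By \<open>R_Suc_less_iff\<close> the distance still exceeds R(1) before the last step,
  so every step raises it to the power p.\<close>

lemma absv_iter_large:
  fixes y :: 'a
  assumes "absv (1 - y) \<le> 1" "R p i < absv (1 - y)"
  shows "absv (1 - y ^ (p ^ i)) = absv (1 - y) ^ (p ^ i)"
  using assms(2)
proof (induction i)
  case (Suc i)
  let ?d = "absv (1 - y)"
  have "R p i < ?d"
    using Suc.prems R_mono[OF prime_p, of i "Suc i"] by simp
  then have IH: "absv (1 - y ^ (p ^ i)) = ?d ^ (p ^ i)"
    by (rule Suc.IH)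
  have "?d ^ (p ^ i) \<le> 1"
    using assms(1) by (simp add: power_le_one)
  moreover have "R p 1 < ?d ^ (p ^ i)"
    using Suc.prems by (subst R_Suc_less_iff[OF prime_p, symmetric]) auto
  ultimately show ?case
    unfolding power_power_Suc by (subst absv_one_minus_power_p_large) (simp_all only: IH)
qed simp

text \<open>Only the last p-th power can start exactly at R(1), where the two leading terms have
  equal size and may cancel; hence an inequality instead of the equality in
  \<open>absv_iter_large\<close>.\<close>

lemma absv_iter_le:
  fixes y :: 'a
  assumes "absv (1 - y) \<le> 1" "R p i \<le> absv (1 - y)"
  shows "absv (1 - y ^ (p ^ i)) \<le> absv (1 - y) ^ (p ^ i)"
proof (cases i)
  case (Suc j)
  let ?d = "absv (1 - y)"
  have "R p j < ?d"
    using assms(2) strict_mono_less[OF strict_mono_R[OF prime_p], of j "Suc j"] Suc by simp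
  then have E: "absv (1 - y ^ (p ^ j)) = ?d ^ (p ^ j)"
    using assms by (intro absv_iter_large)
  have "R p 1 \<le> absv (1 - y ^ (p ^ j))"
    using assms(2) unfolding Suc E by (subst R_Suc_le_iff[OF prime_p, symmetric]) auto
  then have "1 / real p \<le> absv (1 - y ^ (p ^ j)) ^ (p - 1)"
    by (subst (asm) R_1_le_iff[OF prime_p]) auto
  then have "absv (1 - y ^ (p ^ j)) * (1 / real p) \<le> absv (1 - y ^ (p ^ j)) ^ p"
    unfolding power_p_eq by (intro mult_left_mono) auto
  moreover have "absv (1 - y ^ (p ^ j)) \<le> 1"
    unfolding E using assms(1) by (simp add: power_le_one)
  ultimately have "absv (1 - (y ^ (p ^ j)) ^ p) \<le> absv (1 - y ^ (p ^ j)) ^ p"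
    by (intro order_trans[OF absv_one_minus_power_p_le]) auto
  then show ?thesis
    unfolding Suc power_power_Suc E .
qed simp

lemma absv_iter_small:
  fixes y :: 'a
  assumes "absv (1 - y) < R p 1"
  shows "absv (1 - y ^ (p ^ i)) = absv (1 - y) / real p ^ i"
proof (induction i)
  case (Suc i)
  have "absv (1 - y) / real p ^ i \<le> absv (1 - y) / 1"
    using p_gt_1[OF prime_p] by (intro divide_left_mono) auto
  then have "absv (1 - y ^ (p ^ i)) < R p 1"
    using assms Suc by linarith
  then show ?case
    unfolding power_power_Suc by (subst absv_one_minus_power_p_small) (simp_all add: Suc)
qed simp

text \<open>The distance after one p-th power is at most the larger of its p-th power and its
  quotient by p. The former lowers the threshold index by one, the latter is below 1/p <=
  R(1).\<close>

lemma absv_iter_less_R_1: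
  fixes y :: 'a
  assumes "absv (1 - y) < R p (Suc j)"
  shows "absv (1 - y ^ (p ^ j)) < R p 1"
  using assms
proof (induction j arbitrary: y)
  case (Suc j)
  let ?d = "absv (1 - y)"
  note p = p_gt_1[OF prime_p]
  have d: "?d < 1"
    using Suc.prems R_less_1[OF prime_p] by (rule less_trans)
  have "(?d ^ p) ^ (p ^ j) < R p 1"
    using Suc.prems by (subst (asm) less_R_Suc_iff[OF prime_p]) (auto simp: power_mult)
  then have 1: "?d ^ p < R p (Suc j)"
    by (subst less_R_Suc_iff[OF prime_p]) auto
  have "1 / real p \<le> R p 1"
    unfolding R_1_power[OF prime_p, symmetric]
    using R_less_1[OF prime_p, of 1] R_Suc_pos[OF prime_p, of 0] p power_decreasing[of 1 "p - 1" "R p 1"]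
    by simp
  also have "\<dots> \<le> R p (Suc j)"
    by (intro R_mono[OF prime_p]) simp
  finally have "?d / real p < R p (Suc j)"
    using d p divide_strict_right_mono[of ?d 1 "real p"] by simp
  with 1 have "absv (1 - y ^ p) < R p (Suc j)"
    using absv_one_minus_power_p_le[of y] d by simp
  then show ?case
    using Suc.IH[of "y ^ p"] by (simp add: power_mult)
qed simp

text \<open>Once the distance to 1 is below R(1), each p-th power only divides it by p, so it can
  reach 0 only if it is 0 already.\<close>

lemma torsion_near_one:
  fixes y :: 'a
  assumes "y ^ (p ^ k) = 1" "absv (1 - y) < R p (Suc j)"
  shows "y ^ (p ^ j) = 1"
proof -
  have "(y ^ (p ^ j)) ^ (p ^ k) = (y ^ (p ^ k)) ^ (p ^ j)"
    by (simp add: power_mult[symmetric] mult.commute)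
  then have "absv (1 - y ^ (p ^ j)) / real p ^ k = 0"
    using absv_iter_small[OF absv_iter_less_R_1[OF assms(2)], of k] assms(1) by simp
  then show ?thesis
    using p_gt_1[OF prime_p] by simp
qed

end

section \<open>The nearest root of unity of p-power order\<close>

lemma p_power_roots_of_unity_mult:
  assumes "x \<in> p_power_roots_of_unity p" "y \<in> p_power_roots_of_unity p"
  shows "x * y \<in> p_power_roots_of_unity p"
proof -
  obtain i j where "x ^ (p ^ i) = 1" "y ^ (p ^ j) = 1"
    using assms by (auto simp: p_power_roots_of_unity_def)
  moreover have "x ^ (p ^ (i + j)) = (x ^ (p ^ i)) ^ (p ^ j)"
    "y ^ (p ^ (i + j)) = (y ^ (p ^ j)) ^ (p ^ i)"
    by (simp_all add: power_add mult.commute flip: power_mult)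
  ultimately have "(x * y) ^ (p ^ (i + j)) = 1"
    by (simp add: power_mult_distrib)
  then show ?thesis
    by (auto simp: p_power_roots_of_unity_def)
qed

lemma absv_root_of_unity:
  assumes "x ^ n = 1" "0 < n"
  shows "absv x = 1"
proof -
  have "absv x ^ n = 1"
    using assms(1) by (simp flip: absv_power)
  then show ?thesis
    using assms(2) power_eq_iff_eq_base[of n "absv x" 1] by simp
qed

text \<open>For n = p^i, y^n - 1 is the product of n differences y - z^j, each of size at least
  \<open>\<delta>\<close>.\<close>

lemma absv_iter_ge_roots:
  fixes y :: "'a::complete_ultrametric_field"
  assumes Cp: "is_Cp p TYPE('a)"
    and far: "\<And>\<gamma>. \<gamma> \<in> p_power_roots_of_unity p \<Longrightarrow> \<delta> \<le> absv (\<gamma> - y)" and "0 \<le> \<delta>"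
  shows "\<delta> ^ (p ^ i) \<le> absv (1 - y ^ (p ^ i))"
proof -
  have p: "0 < p"
    using Cp by (auto simp: is_Cp_def prime_gt_0_nat)
  obtain z :: 'a where z: "z ^ (p ^ i) = 1" "\<And>j. 0 < j \<Longrightarrow> j < p ^ i \<Longrightarrow> z ^ j \<noteq> 1"
    using exists_primitive_root[OF Cp, of i] by blast
  have "\<delta> ^ (p ^ i) = (\<Prod>j<p ^ i. \<delta>)"
    by simp
  also have "\<dots> \<le> (\<Prod>j<p ^ i. absv (y - z ^ j))"
  proof (intro prod_mono conjI assms(3))
    fix j
    have "(z ^ j) ^ (p ^ i) = 1"
      using z(1) by (metis power_mult mult.commute power_one)
    then show "\<delta> \<le> absv (y - z ^ j)"
      using far[of "z ^ j"] by (auto simp: p_power_roots_of_unity_def absv_minus_commute)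
  qed
  also have "\<dots> = absv (y ^ (p ^ i) - 1)"
    using one_minus_power_prod[OF z] p by (simp add: absv_prod)
  finally show ?thesis
    by (simp add: absv_minus_commute)
qed

lemma finite_roots_of_unity:
  assumes "0 < n"
  shows "finite {x :: 'a::idom. x ^ n = 1}"
proof -
  have "coeff (monom 1 n - 1 :: 'a poly) n = 1"
    using assms by simp
  then have "(monom 1 n - 1 :: 'a poly) \<noteq> 0"
    by (metis coeff_0 zero_neq_one)
  then show ?thesis
    using poly_roots_finite[of "monom 1 n - 1 :: 'a poly"] by (simp add: poly_monom)
qed

locale near_one = residue_char p "TYPE('a)" for p and mu :: "'a::complete_ultrametric_field" +
  assumes Cp: "is_Cp p TYPE('a)" and near: "absv (1 - mu) < 1"
    and no_root: "\<And>n. 0 < n \<Longrightarrow> mu ^ n \<noteq> 1"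
begin

text \<open>With \<open>mu\<close> for lambda^m these are the ingredients of \<open>r_tilde\<close>,
  written so that its definition unfolds to them literally.\<close>

definition d :: real where "d = absv (1 - mu)"
definition s :: nat where "s = R_index p d"
definition \<gamma> :: 'a where
  "\<gamma> = arg_min_on (\<lambda>\<gamma>. absv (\<gamma> - mu)) (p_power_roots_of_unity p)"
definition \<delta> :: real where "\<delta> = absv (\<gamma> - mu)"
definition t :: nat where "t = R_index p \<delta>"

lemma d_pos: "0 < d"
  using no_root[of 1] by (auto simp: d_def)

lemma d_less_1: "d < 1"
  using near by (simp add: d_def)

lemma s_le: "R p s \<le> d" and s_less: "d < R p (Suc s)"
  unfolding s_def using d_pos d_less_1 by (intro R_index[OF prime_p]; simp)+

text \<open>The set of candidates is infinite, so attaining the minimum needs an argument. A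
  candidate that is not a p^s-th root of unity has distance at least R(s + 1) > d from 1, hence more
  than d from \<open>mu\<close>, whereas 1 is at distance d. A minimum over the finite set of p^s-th
  roots of unity is therefore global.\<close>

lemma arg_min_root:
  "\<gamma> \<in> p_power_roots_of_unity p"
  "\<And>x. x \<in> p_power_roots_of_unity p \<Longrightarrow> \<delta> \<le> absv (x - mu)"
proof -
  let ?S = "{x :: 'a. x ^ (p ^ s) = 1}" and ?f = "\<lambda>x. absv (x - mu)"
  have "finite ?S"
    using p_gt_1[OF prime_p] by (intro finite_roots_of_unity) auto
  moreover have "1 \<in> ?S"
    by simp
  ultimately obtain g where g: "g \<in> ?S" "\<And>x. x \<in> ?S \<Longrightarrow> ?f g \<le> ?f x"
    using ex_is_arg_min_if_finite[of ?S ?f] by (fastforce simp: is_arg_min_def not_less)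
  have "?f g \<le> ?f x" if x: "x \<in> p_power_roots_of_unity p" for x
  proof (cases "x \<in> ?S")
    case False
    then have "\<not> absv (1 - x) < R p (Suc s)"
      using torsion_near_one x by (auto simp: p_power_roots_of_unity_def)
    then have "absv (1 - mu) < absv (x - 1)"
      using s_less by (simp add: d_def absv_minus_commute)
    then have "absv ((x - 1) + (1 - mu)) = absv (x - 1)"
      by (rule absv_add_eq_left)
    then have "d \<le> ?f x"
      using \<open>absv (1 - mu) < absv (x - 1)\<close> by (simp add: d_def)
    moreover have "?f g \<le> d"
      using g(2)[of 1] by (simp add: d_def)
    ultimately show ?thesis
      by simp
  qed (use g in auto)
  moreover have "g \<in> p_power_roots_of_unity p"
    using g(1) by (auto simp: p_power_roots_of_unity_def)
  ultimately have "is_arg_min ?f (\<lambda>x. x \<in> p_power_roots_of_unity p) g"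
    by (auto simp: is_arg_min_def not_less)
  then have "is_arg_min ?f (\<lambda>x. x \<in> p_power_roots_of_unity p) \<gamma>"
    unfolding \<gamma>_def arg_min_on_def arg_min_def by (rule someI)
  then show "\<gamma> \<in> p_power_roots_of_unity p"
    "\<And>x. x \<in> p_power_roots_of_unity p \<Longrightarrow> \<delta> \<le> absv (x - mu)"
    by (auto simp: is_arg_min_def not_less \<delta>_def)
qed

lemma \<delta>_le_d: "\<delta> \<le> d"
  using arg_min_root(2)[of 1] by (auto simp: d_def p_power_roots_of_unity_def)

lemma \<delta>_pos: "0 < \<delta>"
proof -
  obtain k where "\<gamma> ^ (p ^ k) = 1"
    using arg_min_root(1) by (auto simp: p_power_roots_of_unity_def)
  then have "\<gamma> \<noteq> mu"
    using no_root[of "p ^ k"] p_gt_1[OF prime_p] by auto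
  then show ?thesis
    by (simp add: \<delta>_def)
qed

lemma t_le: "R p t \<le> \<delta>" and t_less: "\<delta> < R p (Suc t)"
  unfolding t_def using \<delta>_pos \<delta>_le_d d_less_1 by (intro R_index[OF prime_p]; simp)+

lemma t_le_s: "t \<le> s"
proof -
  have "R p t < R p (Suc s)"
    using t_le \<delta>_le_d s_less by linarith
  then show ?thesis
    by (simp only: strict_mono_less[OF strict_mono_R[OF prime_p]] less_Suc_eq_le)
qed

lemma \<gamma>_power: "\<gamma> ^ (p ^ s) = 1"
proof -
  obtain k where "\<gamma> ^ (p ^ k) = 1"
    using arg_min_root(1) by (auto simp: p_power_roots_of_unity_def)
  moreover have "absv (1 - \<gamma>) \<le> d"
    using absv_diff_trans[of 1 \<gamma> mu] \<delta>_le_d by (simp add: d_def \<delta>_def absv_minus_commute[of mu])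
  then have "absv (1 - \<gamma>) < R p (Suc s)"
    using s_less by simp
  ultimately show ?thesis
    by (rule torsion_near_one)
qed

lemma absv_iter_below: "i < s \<Longrightarrow> absv (1 - mu ^ (p ^ i)) = d ^ (p ^ i)"
  unfolding d_def
  using s_le near strict_mono_less[OF strict_mono_R[OF prime_p], of i s]
  by (intro absv_iter_large) (auto simp: d_def)

text \<open>Passing to \<open>nu = mu / \<gamma>\<close> changes no power with exponent p^i, i >= s,
  but brings the base to distance \<open>\<delta>\<close> from 1, with no root of unity of p-power
  order closer. Raising to the power p^t raises the distance to that power; from then on it is below
  R(1) and each step divides it by p.\<close>

lemma absv_iter_above:
  assumes "s \<le> i"
  shows "absv (1 - mu ^ (p ^ i)) = \<delta> ^ (p ^ t) / real p ^ (i - t)"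
proof -
  define nu where "nu = mu / \<gamma>"
  have \<gamma>: "absv \<gamma> = 1"
    using \<gamma>_power p_gt_1[OF prime_p] by (intro absv_root_of_unity) auto
  then have \<gamma>0: "\<gamma> \<noteq> 0"
    by auto
  have "\<gamma> * (1 - nu) = \<gamma> - mu"
    using \<gamma>0 by (simp add: nu_def algebra_simps)
  then have nu: "absv (1 - nu) = \<delta>"
    by (metis \<delta>_def \<gamma> absv_mult mult_1)
  have far: "\<delta> \<le> absv (x - nu)" if "x \<in> p_power_roots_of_unity p" for x
  proof -
    have "\<gamma> * (x - nu) = x * \<gamma> - mu"
      using \<gamma>0 by (simp add: nu_def algebra_simps)
    then have "absv (x - nu) = absv (x * \<gamma> - mu)"
      by (metis \<gamma> absv_mult mult_1)
    then show ?thesis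
      using arg_min_root(2) p_power_roots_of_unity_mult[OF that arg_min_root(1)] by simp
  qed
  \<comment> \<open>If \<open>\<delta>\<close> equals R(t), the iteration alone gives only the upper
    bound; the factorization over roots of unity supplies the lower one.\<close>
  have Ft: "absv (1 - nu ^ (p ^ t)) = \<delta> ^ (p ^ t)"
  proof (rule antisym)
    show "absv (1 - nu ^ (p ^ t)) \<le> \<delta> ^ (p ^ t)"
      using absv_iter_le[of nu t] t_le \<delta>_le_d d_less_1 by (simp add: nu)
    show "\<delta> ^ (p ^ t) \<le> absv (1 - nu ^ (p ^ t))"
      using \<delta>_pos by (intro absv_iter_ge_roots[OF Cp] far) auto
  qed
  have "absv (1 - nu ^ (p ^ t)) < R p 1"
    using t_less \<delta>_pos unfolding Ft by (subst less_R_Suc_iff[OF prime_p, symmetric]) auto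
  then have "absv (1 - (nu ^ (p ^ t)) ^ (p ^ (i - t))) = \<delta> ^ (p ^ t) / real p ^ (i - t)"
    unfolding Ft[symmetric] by (rule absv_iter_small)
  moreover have "(nu ^ (p ^ t)) ^ (p ^ (i - t)) = nu ^ (p ^ i)"
    using assms t_le_s by (simp flip: power_mult power_add)
  moreover have "\<gamma> ^ (p ^ i) = (\<gamma> ^ (p ^ s)) ^ (p ^ (i - s))"
    using assms by (simp flip: power_mult power_add)
  then have "nu ^ (p ^ i) = mu ^ (p ^ i)"
    by (simp add: nu_def power_divide \<gamma>_power)
  ultimately show ?thesis
    by simp
qed

end

subsection \<open>Powers close to one\<close>

lemma absv_power_diff_le:
  assumes "absv x \<le> 1" "absv y \<le> 1"
  shows "absv (x ^ n - y ^ n) \<le> absv (x - y)"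
proof -
  have "absv (\<Sum>i<n. y ^ (n - Suc i) * x ^ i) \<le> 1"
  proof (intro absv_sum_le)
    fix i
    have "absv (y ^ (n - Suc i) * x ^ i) \<le> 1 * 1"
      using assms by (intro absv_mult_le) (auto simp: absv_power power_le_one)
    then show "absv (y ^ (n - Suc i) * x ^ i) \<le> 1"
      by simp
  qed simp
  then have "absv ((x - y) * (\<Sum>i<n. y ^ (n - Suc i) * x ^ i)) \<le> absv (x - y) * 1"
    by (intro absv_mult_le) auto
  then show ?thesis
    by (simp add: power_diff_sumr2)
qed

lemma closure_absv_approx:
  assumes "x \<in> closure S" "0 < e"
  obtains y where "y \<in> S" "absv (x - y) < e"
  using assms by (auto simp: closure_approachable dist_absv absv_minus_commute)

lemma absv_mult_less_1:
  assumes "absv a < 1" "absv b \<le> 1"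
  shows "absv (a * b) < 1"
  using mult_left_le[of "absv b" "absv a"] assms by (simp add: absv_mult)

lemma absv_add_less: "absv a < B \<Longrightarrow> absv b < B \<Longrightarrow> absv (a + b) < B"
  using absv_add[of a b] by simp

context residue_char begin

lemma absv_of_int_less_1_iff: "absv (of_int k :: 'a) < 1 \<longleftrightarrow> int p dvd k"
proof -
  have "1 / real p < 1"
    using p_gt_1[OF prime_p] by simp
  then show ?thesis
    using absv_of_int_dvd[of k] absv_of_int_unit[of k] by (cases "int p dvd k") auto
qed

lemma rational_residue:
  assumes "q \<in> \<rat>" "absv (q :: 'a) \<le> 1"
  obtains c where "absv (q - of_int c) < 1"
proof -
  obtain a b where ab: "b > 0" "coprime a b" "q = of_int a / of_int b"
    using assms(1) by (rule Rats_cases')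
  have eq: "q * of_int b = of_int a"
    using ab by simp
  have nb: "\<not> int p dvd b"
  proof
    assume b: "int p dvd b"
    then have "absv (of_int b * q) < 1"
      using assms(2) absv_of_int_less_1_iff by (intro absv_mult_less_1) auto
    then have "int p dvd a"
      using eq absv_of_int_less_1_iff[of a] by (simp add: mult.commute)
    then have "int p dvd 1"
      using b ab(2) coprime_common_divisor by blast
    then show False
      using p_gt_1[OF prime_p] by simp
  qed
  obtain u v where uv: "u * b + v * int p = 1"
    by (rule inverse_mod_p[OF nb])
  have "(of_int u * of_int b + of_int v * of_nat p :: 'a) = of_int (u * b + v * int p)"
    by simp
  then have uv': "1 - of_int u * of_int b = (of_int v * of_nat p :: 'a)"
    unfolding uv by (simp add: algebra_simps)
  have "(q - of_int (a * u)) * of_int b = of_int a * (1 - of_int u * of_int b)"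
    using eq by (simp add: algebra_simps)
  also have "\<dots> = of_int (p * (a * v))"
    unfolding uv' by simp
  finally have "absv ((q - of_int (a * u)) * of_int b) < 1"
    using absv_of_int_less_1_iff[of "p * (a * v)"] by simp
  then have "absv (q - of_int (a * u)) < 1"
    using absv_of_int_unit[OF nb] by (simp add: absv_mult)
  then show ?thesis
    by (rule that)
qed

text \<open>lambda is approximated by an algebraic x, the coefficients of a polynomial over
  \<open>Qp\<close> vanishing at x by rationals, and these, after division by one of largest size,
  by integers. The result says that the residue class of lambda is algebraic over the field with p
  elements.\<close>

lemma integer_relation:
  assumes Cp: "is_Cp p TYPE('a)" and lam: "absv (lam :: 'a) \<le> 1"
  obtains c N j where "absv (\<Sum>i\<le>N. of_int (c i) * lam ^ i) < 1" "j \<le> N" "\<not> int p dvd c j"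
proof -
  have "lam \<in> closure Qp_bar"
    using Cp by (simp add: is_Cp_def)
  then obtain x where x: "x \<in> Qp_bar" "absv (lam - x) < 1"
    by (rule closure_absv_approx[where e = 1]) auto
  have x1: "absv x \<le> 1"
    using absv_diff[of lam "lam - x"] x(2) lam by simp
  obtain q where q: "q \<noteq> 0" "\<And>i. coeff q i \<in> Qp" "poly q x = 0"
    using x(1) by (auto simp: Qp_bar_def)
  let ?N = "degree q" and ?a = "\<lambda>i. absv (coeff q i)"
  obtain j where j: "j \<le> ?N" "\<And>i. i \<le> ?N \<Longrightarrow> ?a i \<le> ?a j"
  proof -
    have "Max (?a ` {..?N}) \<in> ?a ` {..?N}"
      by (intro Max_in) auto
    then obtain j where "Max (?a ` {..?N}) = ?a j" "j \<in> {..?N}"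
      by (rule imageE)
    moreover have "?a i \<le> Max (?a ` {..?N})" if "i \<le> ?N" for i
      using that by (intro Max_ge) auto
    ultimately show ?thesis
      by (intro that[of j]) simp_all
  qed
  have pos: "0 < ?a j"
    using j(2)[of ?N] q(1) by (metis absv_pos_iff leading_coeff_neq_0 less_le_trans order_refl)
  have "\<exists>r. r \<in> \<rat> \<and> absv (coeff q i - r) < ?a j" for i
    using q(2)[of i] pos closure_absv_approx[of "coeff q i" \<rat> "?a j"] unfolding Qp_def by blast
  then obtain r where r: "\<And>i. r i \<in> \<rat>" "\<And>i. absv (coeff q i - r i) < ?a j"
    by metis
  have rj: "absv (r j) = ?a j"
    using r(2)[of j] by (intro absv_eq_if_close) (simp add: absv_minus_commute)
  then have rj0: "r j \<noteq> 0"
    using pos by auto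
  have ri: "absv (r i / r j) \<le> 1" if "i \<le> ?N" for i
  proof -
    have "absv (r i) \<le> ?a j"
      using absv_diff[of "coeff q i" "coeff q i - r i"] r(2)[of i] j(2)[OF that] by simp
    then show ?thesis
      using pos by (simp add: absv_divide rj del: absv_pos_iff)
  qed
  have "\<exists>c. absv (r i / r j - of_int c) < 1" if "i \<le> ?N" for i
    using rational_residue[of "r i / r j"] r(1) ri[OF that] by (metis Rats_divide)
  then obtain c where c: "\<And>i. i \<le> ?N \<Longrightarrow> absv (r i / r j - of_int (c i)) < 1"
    by metis
  \<comment> \<open>The passage between the two terms is split into three replacements, of the
    integer, of lambda and of the rational, each changing the term by less than 1.\<close>
  have close: "absv (of_int (c i) * lam ^ i - coeff q i / r j * x ^ i) < 1" if i: "i \<le> ?N" for i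
  proof -
    have pw: "absv (lam ^ i) \<le> 1" "absv (x ^ i) \<le> 1"
      using lam x1 by (auto simp: absv_power power_le_one)
    have "absv ((of_int (c i) - r i / r j) * lam ^ i) < 1"
      using c[OF i] pw by (intro absv_mult_less_1) (auto simp: absv_minus_commute)
    moreover have "absv ((lam ^ i - x ^ i) * (r i / r j)) < 1"
      using absv_power_diff_le[OF lam x1, of i] x(2) ri[OF i] by (intro absv_mult_less_1) auto
    moreover have "absv ((r i - coeff q i) / r j * x ^ i) < 1"
      using r(2)[of i] pos pw
      by (intro absv_mult_less_1) (simp_all add: absv_divide rj absv_minus_commute del: absv_pos_iff)
    ultimately have "absv ((of_int (c i) - r i / r j) * lam ^ i + (lam ^ i - x ^ i) * (r i / r j)
        + (r i - coeff q i) / r j * x ^ i) < 1"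
      by (intro absv_add_less)
    moreover have "(of_int (c i) - r i / r j) * lam ^ i + (lam ^ i - x ^ i) * (r i / r j)
        + (r i - coeff q i) / r j * x ^ i = of_int (c i) * lam ^ i - coeff q i / r j * x ^ i"
      using rj0 by (simp add: field_simps)
    ultimately show ?thesis
      by simp
  qed
  have "(\<Sum>i\<le>?N. coeff q i / r j * x ^ i) = poly q x / r j"
    by (simp add: poly_altdef sum_divide_distrib)
  then have "(\<Sum>i\<le>?N. of_int (c i) * lam ^ i)
      = (\<Sum>i\<le>?N. of_int (c i) * lam ^ i - coeff q i / r j * x ^ i)"
    using q(3) by (simp add: sum_subtractf)
  then have "absv (\<Sum>i\<le>?N. of_int (c i) * lam ^ i) < 1"
    using close by (auto intro!: absv_sum_less)
  moreover have "\<not> int p dvd c j"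
    using absv_eq_one_if_close[of "of_int (c j) :: 'a"] c[OF j(1)] rj0
      absv_of_int_less_1_iff[of "c j"] by simp
  ultimately show ?thesis
    using j(1) by (intro that)
qed

text \<open>The relation is cut off at the last coefficient prime to p, since the later terms are
  smaller than 1; multiplying by an inverse modulo p makes the leading coefficient 1 up to a
  multiple of p.\<close>

lemma monic_relation:
  assumes Cp: "is_Cp p TYPE('a)" and lam: "absv (lam :: 'a) \<le> 1"
  obtains e D where "absv (lam ^ D - (\<Sum>i<D. of_int (e i) * lam ^ i)) < 1"
proof -
  obtain c N j where c: "absv (\<Sum>i\<le>N. of_int (c i) * lam ^ i) < 1" "j \<le> N" "\<not> int p dvd c j"
    by (rule integer_relation[OF Cp lam])
  define D where "D = Max {i. i \<le> N \<and> \<not> int p dvd c i}"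
  have fin: "finite {i. i \<le> N \<and> \<not> int p dvd c i}"
    by simp
  have "D \<in> {i. i \<le> N \<and> \<not> int p dvd c i}"
    unfolding D_def using c by (intro Max_in fin) auto
  then have D: "D \<le> N" "\<not> int p dvd c D"
    by auto
  have above: "int p dvd c i" if "D < i" "i \<le> N" for i
  proof (rule ccontr)
    assume "\<not> int p dvd c i"
    then have "i \<le> D"
      unfolding D_def using that by (intro Max_ge fin) simp
    then show False
      using that by simp
  qed
  have pw: "absv (lam ^ i) \<le> 1" for i
    using lam by (simp add: absv_power power_le_one)
  let ?S = "\<Sum>i<D. of_int (c i) * lam ^ i"
  have "{..N} = {..<D} \<union> {D} \<union> {D<..N}"
    using D by auto
  then have "(\<Sum>i\<le>N. of_int (c i) * lam ^ i)
      = ?S + of_int (c D) * lam ^ D + (\<Sum>i\<in>{D<..N}. of_int (c i) * lam ^ i)"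
    by (simp only:) (subst sum.union_disjoint; auto)+
  moreover have "absv (\<Sum>i\<in>{D<..N}. of_int (c i) * lam ^ i) < 1"
    using above pw absv_of_int_less_1_iff by (intro absv_sum_less absv_mult_less_1) auto
  ultimately have S: "absv (?S + of_int (c D) * lam ^ D) < 1"
    using c(1) absv_diff[of "\<Sum>i\<le>N. of_int (c i) * lam ^ i" "\<Sum>i\<in>{D<..N}. of_int (c i) * lam ^ i"]
    by simp
  obtain u v where uv: "u * c D + v * int p = 1"
    by (rule inverse_mod_p[OF D(2)])
  have "(of_int u * of_int (c D) + of_int v * of_nat p :: 'a) = of_int (u * c D + v * int p)"
    by simp
  then have uv': "of_int u * of_int (c D) = (1 - of_int v * of_nat p :: 'a)"
    unfolding uv by (simp add: algebra_simps)
  have "lam ^ D - (\<Sum>i<D. of_int (- u * c i) * lam ^ i)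
      = (?S + of_int (c D) * lam ^ D) * of_int u + of_int (int p * v) * lam ^ D"
  proof -
    have "(?S + of_int (c D) * lam ^ D) * of_int u
        = of_int u * ?S + (of_int u * of_int (c D)) * lam ^ D"
      by (simp add: algebra_simps)
    then show ?thesis
      unfolding uv' by (simp add: algebra_simps sum_negf sum_distrib_left)
  qed
  moreover have "absv ((?S + of_int (c D) * lam ^ D) * of_int u) < 1"
    by (intro absv_mult_less_1 S absv_of_int_le)
  moreover have "absv (of_int (int p * v) * lam ^ D) < 1"
    by (intro absv_mult_less_1 pw) (simp only: absv_of_int_less_1_iff dvd_triv_left)
  ultimately have "absv (lam ^ D - (\<Sum>i<D. of_int (- u * c i) * lam ^ i)) < 1"
    by (simp only: absv_add_less)
  then show ?thesis
    by (rule that)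
qed

text \<open>Up to elements smaller than 1, the monic relation reduces every power of lambda to an
  integer combination of the first D powers, and only the coefficients modulo p matter. There are
  finitely many choices, so two powers agree; dividing by the lower one, a unit, gives n.\<close>

lemma exists_power_near_one:
  assumes Cp: "is_Cp p TYPE('a)" and lam: "absv (lam :: 'a) = 1"
  obtains n where "1 \<le> n" "absv (1 - lam ^ n) < 1"
proof -
  have pw: "absv (lam ^ i) = 1" for i
    using lam by (simp add: absv_power)
  obtain e D where e: "absv (lam ^ D - (\<Sum>i<D. of_int (e i) * lam ^ i)) < 1"
    by (rule monic_relation[OF Cp, of lam]) (use lam in auto)
  let ?comb = "\<lambda>c. \<Sum>i<D. of_int (c i) * lam ^ i"
  have "\<exists>c. absv (lam ^ k - ?comb c) < 1" for k
  proof (induction k rule: less_induct)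
    case (less k)
    show ?case
    proof (cases "k < D")
      case True
      then have "?comb (\<lambda>i. if i = k then 1 else 0) = lam ^ k"
        by (simp add: if_distrib[of of_int] if_distrib[of "\<lambda>x. x * _"] cong: if_cong)
      then show ?thesis
        by (intro exI[of _ "\<lambda>i. if i = k then 1 else 0"]) simp
    next
      \<comment> \<open>For k >= D the relation is multiplied by lambda^(k - D), and the
        combinations known for the lower powers are substituted.\<close>
      case False
      then have "\<exists>c. absv (lam ^ (k - D + i) - ?comb c) < 1" if "i < D" for i
        using less.IH[of "k - D + i"] that by simp
      then obtain c where c: "\<And>i. i < D \<Longrightarrow> absv (lam ^ (k - D + i) - ?comb (c i)) < 1"
        by metis
      have "absv ((lam ^ D - ?comb e) * lam ^ (k - D)) < 1"
        using e pw by (intro absv_mult_less_1) auto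
      moreover have "absv (\<Sum>i<D. (lam ^ (k - D + i) - ?comb (c i)) * of_int (e i)) < 1"
        using c by (intro absv_sum_less absv_mult_less_1 absv_of_int_le) auto
      moreover have "lam ^ k = lam ^ D * lam ^ (k - D)"
        using False by (simp flip: power_add)
      then have "(lam ^ D - ?comb e) * lam ^ (k - D)
          = lam ^ k - (\<Sum>i<D. lam ^ (k - D + i) * of_int (e i))"
        by (simp only: left_diff_distrib sum_distrib_right) (simp add: power_add mult_ac)
      moreover have "?comb (\<lambda>l. \<Sum>i<D. c i l * e i) = (\<Sum>i<D. ?comb (c i) * of_int (e i))"
      proof -
        have "?comb (\<lambda>l. \<Sum>i<D. c i l * e i)
            = (\<Sum>l<D. \<Sum>i<D. of_int (c i l) * lam ^ l * of_int (e i))"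
          by (simp add: sum_distrib_left sum_distrib_right mult_ac)
        also have "\<dots> = (\<Sum>i<D. \<Sum>l<D. of_int (c i l) * lam ^ l * of_int (e i))"
          by (rule sum.swap)
        finally show ?thesis
          by (simp add: sum_distrib_right)
      qed
      ultimately have "absv (lam ^ k - ?comb (\<lambda>l. \<Sum>i<D. c i l * e i)) < 1"
        using absv_add_less[of "(lam ^ D - ?comb e) * lam ^ (k - D)" 1
            "\<Sum>i<D. (lam ^ (k - D + i) - ?comb (c i)) * of_int (e i)"]
        by (simp add: left_diff_distrib sum_subtractf)
      then show ?thesis
        by (rule exI[of _ "\<lambda>l. \<Sum>i<D. c i l * e i"])
    qed
  qed
  then obtain c where c: "\<And>k. absv (lam ^ k - ?comb (c k)) < 1"
    by metis
  \<comment> \<open>\<open>restrict\<close> fixes the values outside \<open>{..<D}\<close>, so that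
    the range of \<open>F\<close> lies in a finite function space.\<close>
  define F where "F k = restrict (\<lambda>i. c k i mod int p) {..<D}" for k
  have "range F \<subseteq> PiE {..<D} (\<lambda>_. {0..<int p})"
  proof (rule image_subsetI)
    fix k
    show "F k \<in> PiE {..<D} (\<lambda>_. {0..<int p})"
      unfolding F_def using p_gt_1[OF prime_p] by (intro restrict_PiE_iff[THEN iffD2]) auto
  qed
  then have "finite (range F)"
    by (rule finite_subset) (auto intro: finite_PiE)
  then have "\<not> inj F"
    using finite_imageD[of F UNIV] by auto
  then obtain k l where kl: "k < l" "F k = F l"
    by (metis injI nat_neq_iff)
  have "absv (?comb (c k) - ?comb (c l)) < 1"
  proof -
    have "absv ((of_int (c k i - c l i)) * lam ^ i) < 1" if "i < D" for i
    proof -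
      have "c k i mod int p = c l i mod int p"
        using fun_cong[OF kl(2), of i] that by (simp add: F_def)
      then have "int p dvd c k i - c l i"
        by (rule mod_eq_dvd_iff[THEN iffD1])
      then show ?thesis
        by (intro absv_mult_less_1) (simp_all only: absv_of_int_less_1_iff pw order_refl)
    qed
    then have "absv (\<Sum>i<D. of_int (c k i - c l i) * lam ^ i) < 1"
      by (intro absv_sum_less) auto
    then show ?thesis
      by (simp add: left_diff_distrib sum_subtractf)
  qed
  then have "absv ((lam ^ k - ?comb (c k)) + (?comb (c k) - ?comb (c l))
      + - (lam ^ l - ?comb (c l))) < 1"
    using c[of k] c[of l] by (intro absv_add_less) (simp_all only: absv_minus)
  then have "absv (lam ^ k - lam ^ l) < 1"
    by simp
  moreover have "lam ^ k - lam ^ l = lam ^ k * (1 - lam ^ (l - k))"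
    using kl(1) by (simp add: algebra_simps flip: power_add)
  ultimately have "absv (1 - lam ^ (l - k)) < 1"
    by (simp add: absv_mult pw)
  then show ?thesis
    using kl(1) by (intro that[of "l - k"]) auto
qed

end

subsection \<open>The average of the small divisors\<close>

lemma card_multiples_le:
  fixes M q :: nat
  assumes "0 < q"
  shows "real (card {j\<in>{1..M}. q dvd j}) \<le> real M / real q"
proof -
  have "{j\<in>{1..M}. q dvd j} \<subseteq> (\<lambda>i. q * i) ` {1..M div q}"
    using assms by (auto elim!: dvdE simp: less_eq_div_iff_mult_less_eq mult.commute)
  then have "card {j\<in>{1..M}. q dvd j} \<le> card {1..M div q}"
    by (rule surj_card_le[rotated]) simp
  then have "real (card {j\<in>{1..M}. q dvd j}) \<le> real (M div q)"
    by simp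
  also have "\<dots> \<le> real M / real q"
    by (rule of_nat_div_le_of_nat)
  finally show ?thesis .
qed

text \<open>The quotient of 1 - y^j by 1 - y is a sum of j powers of y, each at distance less than 1
  from 1; hence it is that close to j, which is a unit.\<close>

lemma (in residue_char) absv_one_minus_power_coprime:
  assumes "absv (1 - y :: 'a) < 1" "\<not> p dvd j"
  shows "absv (1 - y ^ j) = absv (1 - y)"
proof -
  have y: "absv y \<le> 1"
    using absv_eq_one_if_close[OF assms(1)] by simp
  have "absv (y ^ i - 1) < 1" for i
    using absv_one_minus_power_le[OF y, of i] assms(1) by (simp add: absv_minus_commute)
  then have "absv (\<Sum>i<j. y ^ i - 1) < 1"
    by (intro absv_sum_less) auto
  then have "absv ((\<Sum>i<j. y ^ i) - of_nat j) < 1"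
    by (simp add: sum_subtractf)
  moreover have "absv (of_nat j :: 'a) = 1"
    using absv_of_int_unit[of "int j"] assms(2) by simp
  ultimately have "absv (\<Sum>i<j. y ^ i) = 1"
    using absv_eq_if_close[of "\<Sum>i<j. y ^ i" "of_nat j"] by simp
  then show ?thesis
    by (simp add: one_diff_power_eq absv_mult)
qed

context near_one begin

definition omega :: "nat \<Rightarrow> real" where
  "omega i = - ln (absv (1 - mu ^ (p ^ i)))"

text \<open>The increments turn omega(v), for v the p-adic valuation of j, into the sum of theta(i)
  over all i with p^i dividing j. Averaging over j then only needs the density 1/p^i of the
  multiples of p^i.\<close>

definition theta :: "nat \<Rightarrow> real" where
  "theta i = (case i of 0 \<Rightarrow> omega 0 | Suc k \<Rightarrow> omega (Suc k) - omega k)"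

text \<open>The limit of the averages of \<open>- ln \<bar>1 - mu ^ j\<bar>\<close>.\<close>

definition mean_loss :: real where
  "mean_loss = - real s * (1 - 1 / real p) * ln d + omega s / real p ^ s
    + ln (real p) / (real p ^ s * (real p - 1))"

lemma p_gt_1: "1 < p"
  by (rule p_gt_1[OF prime_p])

lemma omega_below: "i < s \<Longrightarrow> omega i = - (real p ^ i * ln d)"
  using d_pos by (simp add: omega_def absv_iter_below ln_realpow)

lemma omega_above:
  "s \<le> i \<Longrightarrow> omega i = (real i - real t) * ln (real p) - real p ^ t * ln \<delta>"
  using \<delta>_pos p_gt_1 t_le_s
  by (simp add: omega_def absv_iter_above ln_realpow ln_div of_nat_diff)

lemma iter_pos: "0 < absv (1 - mu ^ (p ^ i))"
  using no_root[of "p ^ i"] p_gt_1 by simp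

lemma theta_nonneg: "0 \<le> theta i"
proof (cases i)
  case 0
  then show ?thesis
    using near iter_pos[of 0] by (simp add: theta_def omega_def ln_le_zero_iff)
next
  case (Suc k)
  have "absv (mu ^ (p ^ k)) \<le> 1"
    using absv_eq_one_if_close[OF near] by (simp add: absv_power)
  then have "absv (1 - (mu ^ (p ^ k)) ^ p) \<le> absv (1 - mu ^ (p ^ k))"
    by (rule absv_one_minus_power_le)
  then have "ln (absv (1 - mu ^ (p ^ Suc k))) \<le> ln (absv (1 - mu ^ (p ^ k)))"
    using iter_pos[of k] iter_pos[of "Suc k"] unfolding power_power_Suc by (subst ln_le_cancel_iff)
  then show ?thesis
    by (simp add: theta_def omega_def Suc)
qed

lemma sum_theta: "(\<Sum>i\<le>k. theta i) = omega k"
  by (induction k) (simp_all add: theta_def)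

text \<open>For 0 < i < s each summand equals - (1 - 1/p) ln d, since omega(i) is - p^i ln d
  there.\<close>

lemma theta_sum_below:
  "k < s \<Longrightarrow> (\<Sum>i\<le>k. theta i / real p ^ i) = - (real k * (1 - 1 / real p) + 1) * ln d"
proof (induction k)
  case (Suc k)
  then have "(\<Sum>i\<le>Suc k. theta i / real p ^ i)
      = - (real k * (1 - 1 / real p) + 1) * ln d + (omega (Suc k) - omega k) / real p ^ Suc k"
    by (simp add: theta_def)
  also have "(omega (Suc k) - omega k) / real p ^ Suc k = - (1 - 1 / real p) * ln d"
    using Suc.prems p_gt_1 by (simp add: omega_below field_simps)
  finally show ?case
    by (simp add: algebra_simps add_divide_distrib)
qed (simp add: theta_def omega_below)

lemma theta_sum_s:
  "(\<Sum>i\<le>s. theta i / real p ^ i) = - real s * (1 - 1 / real p) * ln d + omega s / real p ^ s"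
proof (cases s)
  case (Suc k)
  have "omega k / real p ^ Suc k = - (1 / real p) * ln d"
    using Suc p_gt_1 by (simp add: omega_below field_simps)
  then show ?thesis
    using theta_sum_below[of k] Suc by (simp add: theta_def diff_divide_distrib algebra_simps)
qed (simp add: theta_def)

text \<open>Every increment after s is ln p, so the rest of the series is geometric; its total is
  the last term of \<open>mean_loss\<close>.\<close>

lemma theta_sum_above:
  "(\<Sum>i\<le>s + n. theta i / real p ^ i)
    = mean_loss - ln (real p) / (real p ^ (s + n) * (real p - 1))"
proof (induction n)
  case 0
  then show ?case
    by (simp add: theta_sum_s mean_loss_def)
next
  case (Suc n)
  have "theta (Suc (s + n)) = ln (real p)"
    by (simp add: theta_def omega_above algebra_simps)
  then have "(\<Sum>i\<le>s + Suc n. theta i / real p ^ i)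
      = mean_loss - ln (real p) / (real p ^ (s + n) * (real p - 1)) + ln (real p) / real p ^ Suc (s + n)"
    using Suc by simp
  also have "\<dots> = mean_loss - ln (real p) / (real p ^ (s + Suc n) * (real p - 1))"
    using p_gt_1 by (simp add: divide_simps) (simp add: algebra_simps)
  finally show ?case .
qed

lemma theta_sum_le: "(\<Sum>i\<le>s + n. theta i / real p ^ i) \<le> mean_loss"
  using p_gt_1 by (simp add: theta_sum_above)

lemma mean_loss_nonneg: "0 \<le> mean_loss"
  by (rule order_trans[OF sum_nonneg theta_sum_le[of 0]]) (auto intro!: divide_nonneg_nonneg theta_nonneg)

text \<open>Write j = p^v l with l prime to p; the exponent l does not change the distance to 1. As
  v < p^v <= j <= M, the range up to s + M contains all relevant i; the offset s fits the form of
  \<open>theta_sum_le\<close>.\<close>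

lemma neg_ln_power_eq:
  assumes "0 < j" "j \<le> M"
  shows "- ln (absv (1 - mu ^ j)) = (\<Sum>i\<le>s + M. if p ^ i dvd j then theta i else 0)"
proof -
  define v where "v = multiplicity p j"
  have np: "\<not> is_unit p"
    using p_gt_1 by simp
  obtain l where l: "j = p ^ v * l" "\<not> p dvd l"
    unfolding v_def using multiplicity_decompose'[of j p] np assms(1) by auto
  have dvd: "p ^ i dvd j \<longleftrightarrow> i \<le> v" for i
    unfolding v_def using power_dvd_iff_le_multiplicity[of j p i] np assms(1) by auto
  have "v < 2 ^ v"
    by (rule less_exp)
  also have "\<dots> \<le> p ^ v"
    using p_gt_1 by (intro power_mono) auto
  also have "\<dots> \<le> j"
    using assms(1) l(1) by (intro dvd_imp_le) auto
  finally have v: "v \<le> s + M"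
    using assms(2) by simp
  have "absv (1 - mu ^ (p ^ v)) < 1"
    using absv_one_minus_power_le[of mu "p ^ v"] absv_eq_one_if_close[OF near] near by simp
  then have "- ln (absv (1 - mu ^ j)) = omega v"
    using l absv_one_minus_power_coprime[of "mu ^ (p ^ v)" l] by (simp add: omega_def power_mult)
  also have "\<dots> = (\<Sum>i\<le>v. theta i)"
    by (simp add: sum_theta)
  also have "\<dots> = (\<Sum>i\<in>{..s + M} \<inter> {i. i \<le> v}. theta i)"
    using v by (intro sum.cong) auto
  also have "\<dots> = (\<Sum>i\<le>s + M. if p ^ i dvd j then theta i else 0)"
    unfolding dvd by (simp add: sum.If_cases)
  finally show ?thesis .
qed

text \<open>After exchanging the sums, \<open>theta i\<close> is counted once for every multiple of
  p^i up to M, at most M/p^i times; \<open>theta_nonneg\<close> makes that estimate usable.\<close>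

lemma sum_neg_ln_le: "(\<Sum>j=1..M. - ln (absv (1 - mu ^ j))) \<le> real M * mean_loss"
proof -
  have "(\<Sum>j=1..M. - ln (absv (1 - mu ^ j)))
      = (\<Sum>j=1..M. \<Sum>i\<le>s + M. if p ^ i dvd j then theta i else 0)"
    by (intro sum.cong refl neg_ln_power_eq) auto
  also have "\<dots> = (\<Sum>i\<le>s + M. \<Sum>j=1..M. if p ^ i dvd j then theta i else 0)"
    by (rule sum.swap)
  also have "\<dots> = (\<Sum>i\<le>s + M. real (card {j\<in>{1..M}. p ^ i dvd j}) * theta i)"
    by (intro sum.cong refl) (simp add: sum.If_cases Int_def)
  also have "\<dots> \<le> (\<Sum>i\<le>s + M. real M / real (p ^ i) * theta i)"
    using p_gt_1 by (intro sum_mono mult_right_mono theta_nonneg card_multiples_le) auto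
  also have "\<dots> = real M * (\<Sum>i\<le>s + M. theta i / real p ^ i)"
    by (simp add: sum_distrib_left)
  also have "\<dots> \<le> real M * mean_loss"
    by (intro mult_left_mono theta_sum_le) simp
  finally show ?thesis .
qed

end

text \<open>Positivity is read off the formula. The other two facts come from ln r = -
  \<open>mean_loss\<close> / m for the claimed radius r, combined with the sign of
  \<open>mean_loss\<close> and with \<open>sum_neg_ln_le\<close> for lambda^m.\<close>

lemma
  fixes lam :: "'a::complete_ultrametric_field"
  assumes Cp: "is_Cp p TYPE('a)"
    and lam: "absv lam = 1"
    and not_root: "\<forall>n\<ge>1. lam ^ n \<noteq> 1"
  shows r_tilde_pos: "0 < r_tilde p lam" and r_tilde_le_1: "r_tilde p lam \<le> 1"
    and r_tilde_power_le: "r_tilde p lam ^ N \<le> (\<Prod>n=1..N. absv (1 - lam ^ n))"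
proof -
  define m where "m = (LEAST n. n \<ge> 1 \<and> absv (1 - lam ^ n) < 1)"
  interpret residue_char p "TYPE('a)"
    using Cp by unfold_locales (auto simp: is_Cp_def)
  obtain n where "n \<ge> 1 \<and> absv (1 - lam ^ n) < 1"
    using exists_power_near_one[OF Cp lam] by blast
  then have m: "m \<ge> 1" "absv (1 - lam ^ m) < 1"
    unfolding m_def using LeastI[of "\<lambda>n. n \<ge> 1 \<and> absv (1 - lam ^ n) < 1"] by blast+
  interpret near_one p "lam ^ m"
    using Cp m not_root by unfold_locales (simp_all flip: power_mult)
  let ?r = "r_tilde p lam"
  have r: "?r = R p (s + 1) powr (1 / real m)
        * real p powr (- ((real s - real t) / (real m * real p ^ s)))
        * d powr (real s * ((real p - 1) / (real m * real p)))
        * \<delta> powr (1 / (real m * real p powr (real s - real t)))"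
    unfolding r_tilde_def m_def[symmetric] Let_def d_def s_def \<gamma>_def \<delta>_def t_def ..
  have R_pos: "0 < R p (s + 1)"
    using R_Suc_pos[OF prime_p, of s] by simp
  show pos: "0 < ?r"
    unfolding r using R_pos d_pos \<delta>_pos p_gt_1 by simp
  have lnR: "ln (R p (s + 1)) = - ln (real p) / (real p ^ s * (real p - 1))"
    using p_gt_1 by (simp add: R_def ln_powr)
  have st: "real p powr (real s - real t) = real p ^ s / real p ^ t"
    using p_gt_1 by (simp add: powr_diff powr_realpow)
  have "ln ?r = 1 / real m * ln (R p (s + 1))
        + (- ((real s - real t) / (real m * real p ^ s))) * ln (real p)
        + (real s * ((real p - 1) / (real m * real p))) * ln d
        + (1 / (real m * real p powr (real s - real t))) * ln \<delta>"
    unfolding r using R_pos d_pos \<delta>_pos p_gt_1 by (simp add: ln_mult ln_powr)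
  \<comment> \<open>The first factor of r yields the geometric tail in \<open>mean_loss\<close>, the
    third its ln d term, and the second and fourth together yield omega(s) / p^s.\<close>
  also have "\<dots> = - mean_loss / real m"
    unfolding mean_loss_def omega_above[OF order_refl] lnR st
    using p_gt_1 m(1) by (simp add: divide_simps) (simp add: algebra_simps)
  finally have ln_r: "ln ?r = - mean_loss / real m" .
  then have "ln ?r \<le> 0"
    using mean_loss_nonneg m(1) by (simp add: divide_nonneg_pos)
  then show "?r \<le> 1"
    using pos by (simp add: ln_le_zero_iff)
  have lam_pow: "absv (lam ^ i) = 1" for i
    by (simp add: absv_power lam)
  \<comment> \<open>For n = m q + i with 0 < i < m, minimality of m gives |1 - lambda^i| = 1, and
    replacing lambda^i by lambda^n changes 1 - lambda^i by less than 1.\<close>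
  have coprime: "absv (1 - lam ^ n) = 1" if "\<not> m dvd n" for n
  proof -
    let ?i = "n mod m"
    have i: "0 < ?i" "?i < m"
      using that m(1) by (auto simp: dvd_eq_mod_eq_0)
    then have "\<not> absv (1 - lam ^ ?i) < 1"
      unfolding m_def using not_less_Least[of ?i "\<lambda>n. n \<ge> 1 \<and> absv (1 - lam ^ n) < 1"]
      by (auto simp: m_def)
    moreover have "absv (1 - lam ^ ?i) \<le> 1"
      using absv_diff[of 1 "lam ^ ?i"] by (simp add: lam_pow)
    ultimately have 1: "absv (1 - lam ^ ?i) = 1"
      by simp
    have "absv (1 - (lam ^ m) ^ (n div m)) < 1"
      using absv_one_minus_power_le[of "lam ^ m" "n div m"] m(2) lam_pow[of m] by simp
    moreover have "lam ^ n = lam ^ ?i * (lam ^ m) ^ (n div m)"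
      by (simp flip: power_mult power_add)
    then have "(1 - lam ^ n) - (1 - lam ^ ?i) = lam ^ ?i * (1 - (lam ^ m) ^ (n div m))"
      by (simp add: algebra_simps)
    ultimately have "absv ((1 - lam ^ n) - (1 - lam ^ ?i)) < absv (1 - lam ^ ?i)"
      by (simp add: absv_mult lam_pow 1)
    then show ?thesis
      using absv_eq_if_close[of "1 - lam ^ n" "1 - lam ^ ?i"] 1 by simp
  qed
  let ?P = "\<Prod>n=1..N. absv (1 - lam ^ n)" and ?M = "N div m"
  have inj: "inj_on ((*) m) {1..?M}"
    using m(1) by (auto simp: inj_on_def)
  have sub: "(*) m ` {1..?M} \<subseteq> {1..N}"
    using m(1) by (auto simp: less_eq_div_iff_mult_less_eq mult.commute Suc_le_eq)
  have "?P = (\<Prod>n\<in>(*) m ` {1..?M}. absv (1 - lam ^ n))"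
  proof (intro prod.mono_neutral_right sub ballI)
    fix n
    assume n: "n \<in> {1..N} - (*) m ` {1..?M}"
    have "\<not> m dvd n"
    proof
      assume "m dvd n"
      then obtain k where "n = m * k" ..
      then have "k \<in> {1..?M}"
        using n m(1) by (auto simp: less_eq_div_iff_mult_less_eq mult.commute Suc_le_eq)
      then show False
        using n \<open>n = m * k\<close> by blast
    qed
    then show "absv (1 - lam ^ n) = 1"
      by (rule coprime)
  qed simp
  also have "\<dots> = (\<Prod>j=1..?M. absv (1 - (lam ^ m) ^ j))"
    by (subst prod.reindex[OF inj]) (simp add: power_mult)
  finally have P: "?P = (\<Prod>j=1..?M. absv (1 - (lam ^ m) ^ j))" .
  have "ln (?r ^ N) = - (real N / real m * mean_loss)"
    using pos ln_r by (simp add: ln_realpow)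
  \<comment> \<open>Rounding N/m down to the number of multiples of m is harmless because
    \<open>mean_loss\<close> is nonnegative.\<close>
  also have "\<dots> \<le> - (real ?M * mean_loss)"
    using mult_right_mono[OF of_nat_div_le_of_nat mean_loss_nonneg, of N m] by simp
  also have "\<dots> \<le> (\<Sum>j=1..?M. ln (absv (1 - (lam ^ m) ^ j)))"
    using sum_neg_ln_le[of ?M] by (simp add: sum_negf)
  also have "\<dots> = ln ?P"
    unfolding P by (subst ln_prod) (auto simp: no_root)
  finally show "?r ^ N \<le> ?P"
    using pos not_root by (subst (asm) ln_le_cancel_iff) (auto intro!: prod_pos)
qed

section \<open>The lower bound for the linearization radius\<close>

theorem theorem1p0p1:
  fixes p :: nat and lam :: "'a::complete_ultrametric_field" and f :: "'a fps"
  assumes "is_Cp p TYPE('a)"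
    and "absv lam = 1"
    and "\<forall>n\<ge>1. lam ^ n \<noteq> 1"
    and "f \<in> G_series lam"
  shows "linearization_radius f \<ge> ereal (r_tilde p lam)"
proof -
  let ?r = "r_tilde p lam" and ?H = "conjugacy_fps f"
  note r = r_tilde_pos[OF assms(1-3)] r_tilde_le_1[OF assms(1-3)]
  have f: "fps_nth f 0 = 0" "fps_nth f 1 = lam" "\<And>n. n \<ge> 2 \<Longrightarrow> absv (fps_nth f n) \<le> 1"
    using assms(4) by (auto simp: G_series_def)
  have f_le: "absv (fps_nth f n) \<le> 1" for n
  proof -
    consider "n = 0" | "n = 1" | "n \<ge> 2"
      by linarith
    then show ?thesis
      using f assms(2) by cases auto
  qed
  then have f1: "fps_bounded 1 1 f"
    by (simp add: fps_bounded_def)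
  \<comment> \<open>As r <= 1, integral coefficients and a zero constant term already give this
    bound for f.\<close>
  have fr: "fps_bounded ?r ?r f"
    unfolding fps_bounded_def
  proof
    fix n
    show "absv (fps_nth f n) * ?r ^ n \<le> ?r"
    proof (cases n)
      case (Suc k)
      have "absv (fps_nth f n) * ?r ^ n \<le> 1 * ?r ^ 1"
        using f_le r Suc by (intro mult_mono power_decreasing) auto
      then show ?thesis
        by simp
    qed (use f r in simp)
  qed
  have H: "fps_nth ?H 0 = 0" "fps_nth ?H 1 = 1" "?H oo f = fps_const (fps_nth f 1) * ?H"
    using assms(2,3) f by (intro conjugacy_fps_properties; auto)+
  have "absv (fps_nth ?H n) * ?r ^ n \<le> ?r" for n
  proof (cases n)
    case (Suc k)
    \<comment> \<open>The coefficient of index k + 1 involves only k small divisors, so r^k is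
      matched by their product and the remaining factor r is the bound itself.\<close>
    have "absv (fps_nth ?H (Suc k)) * ?r ^ k
        \<le> absv (fps_nth ?H (Suc k)) * (\<Prod>n=1..k. absv (1 - lam ^ n))"
      by (intro mult_left_mono r_tilde_power_le assms) simp
    also have "\<dots> \<le> 1"
      using conjugacy_coeff_bound[OF f1 f(1) _ H, of k] assms(2) unfolding f(2) by simp
    finally have "absv (fps_nth ?H (Suc k)) * ?r ^ k * ?r \<le> 1 * ?r"
      using r by (intro mult_right_mono) auto
    then show ?thesis
      using Suc by (simp add: mult_ac)
  qed (use H r in simp)
  then have "fps_bounded ?r ?r ?H"
    by (simp add: fps_bounded_def)
  then have "analytically_conjugate_on ?H f (ball 0 ?r)"
    by (intro analytically_conjugate_on_ball fr f H r)
  then show ?thesis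
    unfolding linearization_radius_def using r by (intro Sup_upper) auto
qed

end
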